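(* Let $(X,d,\mu)$ be a doubling metric measure space and $\alpha\ge 0$. When $\alpha>0$, assume that $X$ is bounded, that $\mu$ satisfies a lower mass bound with exponent $Q>0$, and that $0<\alpha<Q$. (When $\alpha=0$, no boundedness of $X$ and no lower mass bound is required.) Then $M^\alpha$ is bounded from $\mathrm{BMO}(X)$ to $\mathrm{BLO}(X)$: there exists a constant $C>0$, independent of $f$, such that for every $f\in \mathrm{BMO}(X)$ (for which, in the case $\alpha=0$, $M^0f$ is not identically $+\infty$) one has $M^\alpha f\in \mathrm{BLO}(X)$ and $$\|M^\alpha f\|_{\mathrm{BLO}(X)}\le C\,\|f\|_{\mathrm{BMO}(X)}.$$ Furthermore, if $\mu$ satisfies an annular decay property, then $M^\alpha$ maps $\mathrm{VMO}(X)$ to itself: for every $f\in\mathrm{VMO}(X)$ (for which, in the case $\alpha=0$, $M^0f$ is not identically $+\infty$) one has $M^\alpha f\in\mathrm{VMO}(X)$.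
   Context: A metric measure space $(X,d,\mu)$ is a metric space $(X,d)$ with more than one point, equipped with a Borel measure $\mu$ such that $0<\mu(B)<\infty$ for every ball $B\subset X$ of positive finite radius. Balls $B=B(x,r)$ come with a prescribed center $x$ and radius $\mathrm{rad}(B)=r$. $\mu$ is doubling (and $(X,d,\mu)$ is a doubling metric measure space) if there is $C_\mu\ge1$ with $\mu(B(x,2r))\le C_\mu\,\mu(B(x,r))$ for all $x\in X$, $0<r<\infty$. $\mu$ satisfies a lower mass bound with exponent $Q>0$ if there is $0<c_L\le1$ with $\mu(B(x,r))\ge c_L r^Q$ for all $x\in X$ and $0<r<2\,\mathrm{diam}(X)$. $\mu$ satisfies an annular decay property if there exist $0<\beta\le1$ and $C_\beta\ge1$ such that $\mu(B(x,R)\setminus B(x,r))\le C_\beta\left(\frac{R-r}{R}\right)^\beta\mu(B(x,R))$ for all $x\in X$ and $0<r\le R<\infty$. For $f\in L^1_{\mathrm{loc}}(X)$ (integrable on balls), write $f_B=⨍_B f\,d\mu=\frac1{\mu(B)}\int_B f\,d\mu$ and $\mathcal O(f,B)=\frac1{\mu(B)}\int_B|f-f_B|\,d\mu$. $\mathrm{BMO}(X)$ is the set of $f\in L^1_{\mathrm{loc}}(X)$ with $\|f\|_{\mathrm{BMO}(X)}:=\sup_{B}\mathcal O(f,B)<\infty$, supremum over all balls $B\subset X$. $\mathrm{BLO}(X)$ is the set of $f\in L^1_{\mathrm{loc}}(X)$ with $\|f\|_{\mathrm{BLO}(X)}:=\sup_B\frac1{\mu(B)}\int_B\left[f-\operatorname{ess\,inf}_B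 f\right]d\mu<\infty$. $\mathrm{VMO}(X)$ is the set of $f\in\mathrm{BMO}(X)$ with $\lim_{r\to0^+}\sup_{\mathrm{rad}(B)\le r}\mathcal O(f,B)=0$, where the supremum is over all balls $B\subset X$ of radius at most $r$. For $f\in L^1_{\mathrm{loc}}(X)$ and $\alpha\ge0$, the (uncentered) fractional maximal function is $$M^\alpha f(x)=\sup_{B\ni x}\mathrm{rad}(B)^\alpha\,\frac1{\mu(B)}\int_B|f|\,d\mu,$$ the supremum being over all balls $B\subset X$ containing $x$ with $0<\mathrm{rad}(B)<2\,\mathrm{diam}(X)$. *)

theory Defs
  imports "HOL-Analysis.Analysis"
begin

text \<open>
  The underlying metric space is the whole type \<open>'a\<close>. A ball is represented by its prescribed
  center and radius, so suprema over balls range over pairs \<open>(z, r)\<close> with \<open>r > 0\<close>; the set of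
  points of the ball is the open ball \<open>ball z r\<close>.
\<close>

locale metric_measure_space =
  fixes M :: "'a::metric_space measure"
  assumes more_than_one_point: "\<exists>x y :: 'a. x \<noteq> y"
    and sets_eq_borel: "sets M = sets borel"
    and ball_pos: "0 < r \<Longrightarrow> 0 < emeasure M (ball x r)"
    and ball_finite: "0 < r \<Longrightarrow> emeasure M (ball x r) < \<infinity>"

locale doubling_metric_measure_space = metric_measure_space +
  assumes doubling:
    "\<exists>C\<ge>1. \<forall>x r. 0 < r \<longrightarrow> measure M (ball x (2 * r)) \<le> C * measure M (ball x r)"

text \<open>The library's \<^const>\<open>diameter\<close> is real-valued, hence meaningless on unbounded sets.\<close>

definition ediam :: "'a::metric_space set \<Rightarrow> ereal" where
  "ediam S = (if bounded S then ereal (diameter S) else \<infinity>)"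

definition lower_mass_bound :: "'a::metric_space measure \<Rightarrow> real \<Rightarrow> bool" where
  "lower_mass_bound M Q \<longleftrightarrow>
     (\<exists>c. 0 < c \<and> c \<le> 1 \<and>
       (\<forall>x r. 0 < r \<and> ereal r < 2 * ediam (UNIV :: 'a set) \<longrightarrow>
          c * r powr Q \<le> measure M (ball x r)))"

definition annular_decay :: "'a::metric_space measure \<Rightarrow> bool" where
  "annular_decay M \<longleftrightarrow>
     (\<exists>\<beta> C. 0 < \<beta> \<and> \<beta> \<le> 1 \<and> 1 \<le> C \<and>
       (\<forall>x r R. 0 < r \<and> r \<le> R \<longrightarrow>
          measure M (ball x R - ball x r) \<le> C * ((R - r) / R) powr \<beta> * measure M (ball x R)))"

definition L1_loc :: "'a::metric_space measure \<Rightarrow> ('a \<Rightarrow> real) set" where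
  "L1_loc M = {f. \<forall>x r. 0 < r \<longrightarrow> set_integrable M (ball x r) f}"

definition average :: "'a measure \<Rightarrow> 'a set \<Rightarrow> ('a \<Rightarrow> real) \<Rightarrow> real" where
  "average M B f = (LINT y:B|M. f y) / measure M B"

definition mean_oscillation :: "'a measure \<Rightarrow> ('a \<Rightarrow> real) \<Rightarrow> 'a set \<Rightarrow> real" where
  "mean_oscillation M f B = average M B (\<lambda>y. \<bar>f y - average M B f\<bar>)"

definition BMO_norm :: "'a::metric_space measure \<Rightarrow> ('a \<Rightarrow> real) \<Rightarrow> ennreal" where
  "BMO_norm M f = (SUP (z, r) \<in> UNIV \<times> {0<..}. ennreal (mean_oscillation M f (ball z r)))"

definition BMO :: "'a::metric_space measure \<Rightarrow> ('a \<Rightarrow> real) set" where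
  "BMO M = {f \<in> L1_loc M. BMO_norm M f < \<infinity>}"

definition VMO :: "'a::metric_space measure \<Rightarrow> ('a \<Rightarrow> real) set" where
  "VMO M = {f \<in> BMO M.
     ((\<lambda>r. SUP (z, s) \<in> UNIV \<times> {0<..r}. ennreal (mean_oscillation M f (ball z s))) \<longlongrightarrow> 0)
       (at_right 0)}"

definition essinf_on :: "'a measure \<Rightarrow> 'a set \<Rightarrow> ('a \<Rightarrow> real) \<Rightarrow> ereal" where
  "essinf_on M B f = Sup {c. AE y in M. y \<in> B \<longrightarrow> c \<le> ereal (f y)}"

text \<open>
  The integrand \<open>f - essinf_on M B f\<close> is nonnegative almost everywhere on \<open>B\<close>, so the truncation
  performed by \<^const>\<open>e2ennreal\<close> is harmless; the norm is \<open>\<infinity>\<close> if \<open>f\<close> is essentially unbounded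
  below on some ball.
\<close>

definition BLO_norm :: "'a::metric_space measure \<Rightarrow> ('a \<Rightarrow> real) \<Rightarrow> ennreal" where
  "BLO_norm M f = (SUP (z, r) \<in> UNIV \<times> {0<..}.
     (\<integral>\<^sup>+ y \<in> ball z r. e2ennreal (ereal (f y) - essinf_on M (ball z r) f) \<partial>M)
       / emeasure M (ball z r))"

definition BLO :: "'a::metric_space measure \<Rightarrow> ('a \<Rightarrow> real) set" where
  "BLO M = {f \<in> L1_loc M. BLO_norm M f < \<infinity>}"

text \<open>
  The maximal function may take the value \<open>\<infinity>\<close>. It is regarded as an element of a space of
  (classes of) real-valued functions by requiring it to be finite almost everywhere and
  passing to \<^const>\<open>enn2real\<close>.
\<close>

definition frac_maximal ::
    "'a::metric_space measure \<Rightarrow> real \<Rightarrow> ('a \<Rightarrow> real) \<Rightarrow> 'a \<Rightarrow> ennreal" where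
  "frac_maximal M \<alpha> f x =
     (SUP (z, r) \<in> {(z, r). x \<in> ball z r \<and> 0 < r \<and> ereal r < 2 * ediam (UNIV :: 'a set)}.
        ennreal (r powr \<alpha>) * ((\<integral>\<^sup>+ y \<in> ball z r. ennreal \<bar>f y\<bar> \<partial>M) / emeasure M (ball z r)))"

end

theory Submission
  imports Defs
begin

text \<open>
  Let \<open>h = \<bar>f\<bar>\<close> and let \<open>B\<close> be a ball of radius \<open>r\<close>. For \<open>y\<close> in \<open>B\<close>, the balls of radius at most \<open>N r\<close>
  contribute to the maximal function at \<open>y\<close> at most its infimum over \<open>B\<close> plus a multiple of the
  maximal function of \<open>h - h\<^bsub>3NB\<^esub>\<close> over these balls. A ball \<open>B'\<close> of larger radius is compared with
  the concentric ball \<open>B''\<close> whose radius is larger by \<open>2 r\<close>: it contains \<open>B\<close>, so that its contribution is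
  at most the infimum over \<open>B\<close>, and the difference of the two averages is at most a multiple of the BMO norm;
  under annular decay this multiple tends to \<open>0\<close> as \<open>N\<close> grows.

  The mean over \<open>B\<close> of the maximal function of \<open>h - h\<^bsub>3B\<^esub>\<close> over small balls is bounded by the
  oscillation of \<open>h\<close> without the John-Nirenberg inequality: by a Vitali covering, the best constant \<open>A\<close>
  in this estimate (finite if the radii are bounded from below) satisfies \<open>A \<le> C w + A / 2\<close>.

  The exponent \<open>\<alpha>\<close> enters only through the boundedness of \<open>rad(B)\<^sup>\<alpha>\<close> over admissible balls.
\<close>

subsection \<open>Covering and averages\<close>

text \<open>Zorn's lemma is applied to disjoint subfamilies \<open>J\<close> with an extra property:
  a ball of \<open>I\<close> that meets \<open>J\<close> also meets a member of at least half its
  radius. Disjointness alone would not control the radii; with this property the factor 5 arises as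
  \<open>1 + 2 * 2\<close>.\<close>

lemma Vitali_covering:
  fixes I :: "('a::metric_space \<times> real) set"
  assumes I: "\<And>p. p \<in> I \<Longrightarrow> 0 < snd p \<and> snd p \<le> R"
  obtains J where "J \<subseteq> I"
    and "disjoint_family_on (\<lambda>p. ball (fst p) (snd p)) J"
    and "\<And>p. p \<in> I \<Longrightarrow> \<exists>q\<in>J. snd p \<le> 2 * snd q \<and> ball (fst p) (snd p) \<subseteq> ball (fst q) (5 * snd q)"
proof -
  define B where "B = (\<lambda>p::'a \<times> real. ball (fst p) (snd p))"
  define F where "F = {J. J \<subseteq> I \<and> disjoint_family_on B J \<and>
    (\<forall>p\<in>I. (\<exists>q\<in>J. B p \<inter> B q \<noteq> {}) \<longrightarrow> (\<exists>q\<in>J. B p \<inter> B q \<noteq> {} \<and> snd p \<le> 2 * snd q))}"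
  have "\<exists>J\<in>F. \<forall>X\<in>F. J \<subseteq> X \<longrightarrow> X = J"
  proof (rule subset_Zorn')
    fix C assume C: "subset.chain F C"
    have JF: "J \<in> F" if "J \<in> C" for J
      using C that by (auto simp: subset_chain_def)
    have sub: "J \<subseteq> I" if "J \<in> C" for J
      using JF[OF that] by (simp add: F_def)
    have dis: "disjoint_family_on B J" if "J \<in> C" for J
      using JF[OF that] by (simp add: F_def)
    have pr: "\<exists>q\<in>J. B p \<inter> B q \<noteq> {} \<and> snd p \<le> 2 * snd q"
      if "J \<in> C" "p \<in> I" "\<exists>q\<in>J. B p \<inter> B q \<noteq> {}" for J p
      using JF[OF that(1)] that(2,3) by (simp add: F_def)
    have "disjoint_family_on B (\<Union>C)"
      unfolding disjoint_family_on_def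
    proof (intro ballI impI)
      fix p q assume "p \<in> \<Union>C" "q \<in> \<Union>C" "p \<noteq> q"
      then obtain J K where JK: "J \<in> C" "K \<in> C" "p \<in> J" "q \<in> K"
        by blast
      then have "J \<subseteq> K \<or> K \<subseteq> J"
        using C by (auto simp: subset_chain_def)
      then show "B p \<inter> B q = {}"
        using JK dis[of J] dis[of K] \<open>p \<noteq> q\<close> unfolding disjoint_family_on_def by blast
    qed
    moreover have "\<exists>q\<in>\<Union>C. B p \<inter> B q \<noteq> {} \<and> snd p \<le> 2 * snd q"
      if "p \<in> I" "\<exists>q\<in>\<Union>C. B p \<inter> B q \<noteq> {}" for p
    proof -
      from that(2) obtain q J where "J \<in> C" "q \<in> J" "B p \<inter> B q \<noteq> {}"
        by blast
      then have "\<exists>q\<in>J. B p \<inter> B q \<noteq> {} \<and> snd p \<le> 2 * snd q"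
        using pr[OF \<open>J \<in> C\<close> \<open>p \<in> I\<close>] by blast
      then show ?thesis
        using \<open>J \<in> C\<close> by blast
    qed
    moreover have "\<Union>C \<subseteq> I"
      using sub by blast
    ultimately show "\<Union>C \<in> F"
      unfolding F_def by blast
  qed
  then obtain J where J: "J \<in> F" and maxJ: "\<And>X. X \<in> F \<Longrightarrow> J \<subseteq> X \<Longrightarrow> X = J"
    by blast
  have J_sub: "J \<subseteq> I" and J_disj: "disjoint_family_on B J"
    and J_prop: "\<And>p. p \<in> I \<Longrightarrow> \<exists>q\<in>J. B p \<inter> B q \<noteq> {} \<Longrightarrow> \<exists>q\<in>J. B p \<inter> B q \<noteq> {} \<and> snd p \<le> 2 * snd q"
    using J by (simp_all add: F_def)
  \<comment> \<open>The balls of \<open>I\<close> that miss all of \<open>J\<close>. If there were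
    any, one of nearly maximal radius could be added to \<open>J\<close> without leaving
    \<open>F\<close>: up to a factor 2 it dominates every ball in \<open>U\<close>, and the balls
    outside \<open>U\<close> already meet \<open>J\<close>.\<close>
  define U where "U = {p \<in> I. \<forall>q\<in>J. B p \<inter> B q = {}}"
  have "U = {}"
  proof (rule ccontr)
    assume "U \<noteq> {}"
    define s where "s = Sup (snd ` U)"
    have bdd: "bdd_above (snd ` U)"
      using I unfolding U_def bdd_above_def by (intro exI[of _ R]) auto
    have le_s: "snd p \<le> s" if "p \<in> U" for p
      unfolding s_def using bdd that by (intro cSup_upper) auto
    have "0 < s"
    proof -
      obtain p where p: "p \<in> U"
        using \<open>U \<noteq> {}\<close> by blast
      then have "0 < snd p"
        using I unfolding U_def by blast
      then show ?thesis
        using le_s[OF p] by linarith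
    qed
    then have "s / 2 < Sup (snd ` U)"
      unfolding s_def by simp
    then obtain u where u: "u \<in> U" "s / 2 < snd u"
      using less_cSupD[of "snd ` U" "s / 2"] \<open>U \<noteq> {}\<close> by blast
    have u_large: "snd p \<le> 2 * snd u" if "p \<in> U" for p
      using le_s[OF that] u(2) by simp
    have "insert u J \<in> F"
    proof -
      have "insert u J \<subseteq> I"
        using u J_sub unfolding U_def by blast
      moreover have "disjoint_family_on B (insert u J)"
        using J_disj u unfolding U_def disjoint_family_on_def by blast
      moreover have "\<exists>q\<in>insert u J. B p \<inter> B q \<noteq> {} \<and> snd p \<le> 2 * snd q"
        if "p \<in> I" "\<exists>q\<in>insert u J. B p \<inter> B q \<noteq> {}" for p
      proof (cases "p \<in> U")
        case True
        then have "B p \<inter> B u \<noteq> {}"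
          using that(2) unfolding U_def by blast
        then show ?thesis
          using u_large[OF True] by blast
      next
        case False
        then show ?thesis
          using J_prop[OF that(1)] that(1) unfolding U_def by blast
      qed
      ultimately show ?thesis
        unfolding F_def by blast
    qed
    then have "u \<in> J"
      using maxJ by blast
    then have "B u = {}"
      using u unfolding U_def by blast
    then show False
      using I[of u] u unfolding U_def B_def by auto
  qed
  have "\<exists>q\<in>J. snd p \<le> 2 * snd q \<and> B p \<subseteq> ball (fst q) (5 * snd q)" if p: "p \<in> I" for p
  proof -
    have "\<exists>q\<in>J. B p \<inter> B q \<noteq> {}"
      using p \<open>U = {}\<close> unfolding U_def by blast
    then obtain q where q: "q \<in> J" "B p \<inter> B q \<noteq> {}" "snd p \<le> 2 * snd q"
      using J_prop[OF p] by blast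
    then obtain w where w: "dist (fst p) w < snd p" "dist (fst q) w < snd q"
      unfolding B_def by auto
    have "B p \<subseteq> ball (fst q) (5 * snd q)"
    proof
      fix v assume "v \<in> B p"
      then have "dist (fst p) v < snd p"
        by (simp add: B_def)
      moreover have "dist (fst q) v \<le> dist (fst q) w + (dist (fst p) w + dist (fst p) v)"
        using dist_triangle[of "fst q" v w] dist_triangle3[of w v "fst p"] by linarith
      ultimately show "v \<in> ball (fst q) (5 * snd q)"
        using w q(3) by simp
    qed
    then show ?thesis
      using q by blast
  qed
  then show thesis
    using that[OF J_sub] J_disj unfolding B_def by blast
qed

text \<open>One doubling constant is fixed, so that later bounds are explicit in powers of
  \<open>D\<close> and hence uniform in the function.\<close>

locale doubling_constant = metric_measure_space M for M :: "'a::metric_space measure" +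
  fixes D :: real
  assumes D_ge_1: "1 \<le> D"
    and doubling_D: "0 < r \<Longrightarrow> measure M (ball x (2 * r)) \<le> D * measure M (ball x r)"
begin

abbreviation vol where "vol x r \<equiv> measure M (ball x r)"
abbreviation avg where "avg f x r \<equiv> average M (ball x r) f"
abbreviation osc where "osc f x r \<equiv> mean_oscillation M f (ball x r)"

section \<open>Volumes of balls under doubling\<close>

lemma space_M [simp]: "space M = UNIV"
  using sets_eq_borel sets_eq_imp_space_eq[of M borel] by simp

lemma sets_open [measurable, simp]: "open S \<Longrightarrow> S \<in> sets M"
  by (simp add: sets_eq_borel)

lemma emeasure_ball: "emeasure M (ball x r) = ennreal (vol x r)"
proof (cases "0 < r")
  case True
  then show ?thesis
    using ball_finite[OF True] by (simp add: emeasure_eq_ennreal_measure less_top)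
next
  case False
  then show ?thesis
    by (simp add: ball_empty)
qed

lemma vol_pos: "0 < r \<Longrightarrow> 0 < vol x r"
  using ball_pos[of r x] by (simp add: emeasure_ball)

lemma vol_mono:
  assumes "ball x r \<subseteq> ball y s"
  shows "vol x r \<le> vol y s"
  by (rule measure_mono_fmeasurable[OF assms]) (simp_all add: fmeasurable_def emeasure_ball)

lemma ball_subset: "dist x y + r \<le> s \<Longrightarrow> ball x r \<subseteq> ball y s"
  for x y :: 'a
proof
  fix w assume "dist x y + r \<le> s" "w \<in> ball x r"
  then show "w \<in> ball y s"
    using dist_triangle3[of y w x] by simp
qed

lemma vol_doubling_power:
  assumes "0 < r"
  shows "vol x (2 ^ k * r) \<le> D ^ k * vol x r"
proof (induction k)
  case (Suc k)
  have "vol x (2 ^ Suc k * r) \<le> D * vol x (2 ^ k * r)"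
    using doubling_D[of "2 ^ k * r" x] assms by (simp add: mult.assoc)
  also have "\<dots> \<le> D * (D ^ k * vol x r)"
    using Suc D_ge_1 by (intro mult_left_mono) auto
  finally show ?case
    by simp
qed simp

text \<open>\<open>ball x r\<close> lies in \<open>ball y (2 ^ k * s)\<close>, which costs
  \<open>k\<close> doublings. The powers of \<open>D\<close> below count such doublings.\<close>

lemma vol_compare:
  assumes "0 < s" "dist x y + r \<le> 2 ^ k * s"
  shows "vol x r \<le> D ^ k * vol y s"
  using vol_mono[OF ball_subset[OF assms(2)]] vol_doubling_power[OF assms(1)] by (rule order_trans)

section \<open>Local integrability, averages and mean oscillation\<close>

lemma L1_loc_integrable: "f \<in> L1_loc M \<Longrightarrow> set_integrable M (ball x r) f"
  by (cases "0 < r") (auto simp: L1_loc_def ball_empty)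

lemma const_integrable: "set_integrable M (ball x r) (\<lambda>_. c::real)"
  by (simp add: set_integrable_def emeasure_ball)

lemma L1_loc_abs_diff: "f \<in> L1_loc M \<Longrightarrow> (\<lambda>u. \<bar>f u - c\<bar>) \<in> L1_loc M"
  unfolding L1_loc_def by (auto intro!: set_integrable_abs set_integral_diff const_integrable)

lemma L1_loc_abs: "f \<in> L1_loc M \<Longrightarrow> (\<lambda>u. \<bar>f u\<bar>) \<in> L1_loc M"
  using L1_loc_abs_diff[of f 0] by simp

lemma set_integral_ball_const: "(LINT u:ball x r|M. c) = vol x r * (c::real)"
  using set_integral_const[of "ball x r" M c] by (simp add: emeasure_ball)

lemma set_integral_eq_avg: "0 < r \<Longrightarrow> (LINT u:ball x r|M. f u) = avg f x r * vol x r"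
  using vol_pos[of r x] by (simp add: average_def)

lemma set_integral_nonneg':
  assumes "\<And>u. 0 \<le> f u"
  shows "0 \<le> (LINT u:S|M. (f u :: real))"
  unfolding set_lebesgue_integral_def by (rule Bochner_Integration.integral_nonneg) (simp add: assms)

lemma avg_nonneg: "(\<And>u. 0 \<le> f u) \<Longrightarrow> 0 \<le> avg f x r"
  by (simp add: average_def set_integral_nonneg')

lemma osc_nonneg: "0 \<le> osc f x r"
  by (simp add: mean_oscillation_def avg_nonneg)

lemma avg_mono:
  assumes "f \<in> L1_loc M" "g \<in> L1_loc M" "\<And>u. f u \<le> g u"
  shows "avg f x r \<le> avg g x r"
  unfolding average_def
  by (intro divide_right_mono set_integral_mono L1_loc_integrable) (auto simp: assms)

lemma avg_add_const:
  assumes "f \<in> L1_loc M" "0 < r"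
  shows "avg (\<lambda>u. f u + c) x r = avg f x r + c"
proof -
  have "(LINT u:ball x r|M. f u + c) = (LINT u:ball x r|M. f u) + vol x r * c"
    using set_integral_add(2)[OF L1_loc_integrable[OF assms(1)] const_integrable, of x r c]
    by (simp add: set_integral_ball_const)
  then show ?thesis
    using vol_pos[OF assms(2), of x] by (simp add: average_def field_simps)
qed

lemma L1_loc_add_const: "f \<in> L1_loc M \<Longrightarrow> (\<lambda>u. f u + c) \<in> L1_loc M"
  unfolding L1_loc_def by (auto intro!: set_integral_add const_integrable)

lemma avg_abs_diff_triangle:
  assumes "f \<in> L1_loc M" "0 < r"
  shows "avg (\<lambda>u. \<bar>f u - c\<bar>) x r \<le> avg (\<lambda>u. \<bar>f u - d\<bar>) x r + \<bar>d - c\<bar>"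
proof -
  have "avg (\<lambda>u. \<bar>f u - c\<bar>) x r \<le> avg (\<lambda>u. \<bar>f u - d\<bar> + \<bar>d - c\<bar>) x r"
    using assms by (intro avg_mono L1_loc_add_const L1_loc_abs_diff) auto
  then show ?thesis
    using avg_add_const[OF L1_loc_abs_diff[OF assms(1)] assms(2)] by simp
qed

lemma abs_avg_diff_le:
  fixes f :: "'a \<Rightarrow> real"
  assumes "f \<in> L1_loc M" "0 < r"
  shows "\<bar>avg f x r - c\<bar> \<le> avg (\<lambda>u. \<bar>f u - c\<bar>) x r"
proof -
  have "\<bar>avg (\<lambda>u. f u + - c) x r\<bar> \<le> avg (\<lambda>u. \<bar>f u - c\<bar>) x r"
    unfolding average_def set_lebesgue_integral_def
    using integral_abs_bound[of M "\<lambda>u. indicat_real (ball x r) u *\<^sub>R (f u + - c)"]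
    by (simp add: abs_mult divide_right_mono)
  then show ?thesis
    using avg_add_const[OF assms, of x "- c"] by simp
qed

text \<open>Replacing the mean by \<open>c\<close> costs the distance from \<open>c\<close> to the
  mean, which is itself at most the average of \<open>\<bar>f - c\<bar>\<close>.\<close>

lemma osc_le_avg:
  fixes f :: "'a \<Rightarrow> real"
  assumes "f \<in> L1_loc M" "0 < r"
  shows "osc f x r \<le> 2 * avg (\<lambda>u. \<bar>f u - c\<bar>) x r"
  using avg_abs_diff_triangle[OF assms, of x "avg f x r" c] abs_avg_diff_le[OF assms, of x c]
  unfolding mean_oscillation_def by linarith

text \<open>The reverse triangle inequality compares \<open>\<bar>f\<bar>\<close> with the constant
  \<open>\<bar>avg f x r\<bar>\<close>. The maximal function sees only \<open>\<bar>f\<bar>\<close>,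
  so the oscillation of \<open>f\<close> always enters through this bound.\<close>

lemma osc_abs_le:
  assumes "f \<in> L1_loc M" "0 < r"
  shows "osc (\<lambda>u. \<bar>f u\<bar>) x r \<le> 2 * osc f x r"
proof -
  have "avg (\<lambda>u. \<bar>\<bar>f u\<bar> - \<bar>avg f x r\<bar>\<bar>) x r \<le> avg (\<lambda>u. \<bar>f u - avg f x r\<bar>) x r"
    using assms by (intro avg_mono L1_loc_abs_diff L1_loc_abs) auto
  then show ?thesis
    using osc_le_avg[OF L1_loc_abs[OF assms(1)] assms(2), of x "\<bar>avg f x r\<bar>"]
    unfolding mean_oscillation_def by linarith
qed

lemma set_integral_subset_mono:
  fixes f :: "'a \<Rightarrow> real"
  assumes "\<And>u. 0 \<le> f u" "set_integrable M S f" "T \<in> sets M" "T \<subseteq> S"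
  shows "(LINT u:T|M. f u) \<le> (LINT u:S|M. f u)"
  unfolding set_lebesgue_integral_def
  using assms set_integrable_subset[OF assms(2-4)]
  by (intro integral_mono) (auto simp: set_integrable_def indicator_def)

text \<open>The first distance condition places \<open>ball z s\<close> inside
  \<open>ball x r\<close>; the second bounds the ratio of the two volumes by
  \<open>D ^ k\<close>.\<close>

lemma avg_le_ball_avg:
  assumes "f \<in> L1_loc M" "\<And>u. 0 \<le> f u" "0 < r" "0 < s"
    and "dist z x + s \<le> r" "dist x z + r \<le> 2 ^ k * s"
  shows "avg f z s \<le> D ^ k * avg f x r"
proof -
  have "avg f z s * vol z s \<le> avg f x r * vol x r"
    using set_integral_subset_mono[OF assms(2) L1_loc_integrable[OF assms(1)] _ ball_subset[OF assms(5)]]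
    by (simp add: assms set_integral_eq_avg)
  also have "\<dots> \<le> avg f x r * (D ^ k * vol z s)"
    using vol_compare[OF assms(4,6)] avg_nonneg[OF assms(2)] by (intro mult_left_mono) auto
  finally have "avg f z s * vol z s \<le> (D ^ k * avg f x r) * vol z s"
    by (simp only: mult_ac)
  then show ?thesis
    using vol_pos[OF assms(4), of z] by (rule mult_right_le_imp_le)
qed

lemma avg_abs_diff_le_osc:
  assumes "f \<in> L1_loc M" "0 < r" "0 < s" "dist z x + s \<le> r" "dist x z + r \<le> 2 ^ k * s"
  shows "avg (\<lambda>u. \<bar>f u - avg f x r\<bar>) z s \<le> D ^ k * osc f x r"
  unfolding mean_oscillation_def
  using assms by (intro avg_le_ball_avg L1_loc_abs_diff) auto

lemma abs_avg_diff_le_osc: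
  assumes "f \<in> L1_loc M" "0 < r" "0 < s" "dist z x + s \<le> r" "dist x z + r \<le> 2 ^ k * s"
  shows "\<bar>avg f z s - avg f x r\<bar> \<le> D ^ k * osc f x r"
  using abs_avg_diff_le[OF assms(1,3)] avg_abs_diff_le_osc[OF assms] by (rule order_trans)

section \<open>Disjoint families of balls\<close>

lemma sum_set_integral_le:
  fixes f :: "'a \<Rightarrow> real"
  assumes "finite J" "disjoint_family_on A J" "\<And>j. j \<in> J \<Longrightarrow> A j \<in> sets M \<and> A j \<subseteq> S"
    and "\<And>u. 0 \<le> f u" "set_integrable M S f"
  shows "(\<Sum>j\<in>J. LINT u:A j|M. f u) \<le> (LINT u:S|M. f u)"
proof -
  have "(\<Sum>j\<in>J. LINT u:A j|M. f u) = (LINT u:(\<Union>j\<in>J. A j)|M. f u)"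
    using assms by (intro set_integral_finite_Union[symmetric]) (auto intro: set_integrable_subset)
  also have "\<dots> \<le> (LINT u:S|M. f u)"
    using assms by (intro set_integral_subset_mono) auto
  finally show ?thesis .
qed

lemma sum_vol_le:
  assumes "finite J" "disjoint_family_on (\<lambda>p. ball (fst p) (snd p)) J"
    and "\<And>p. p \<in> J \<Longrightarrow> ball (fst p) (snd p) \<subseteq> S" "S \<in> sets M" "S \<subseteq> ball x r"
  shows "(\<Sum>p\<in>J. vol (fst p) (snd p)) \<le> measure M S"
proof -
  have "emeasure M S \<noteq> \<infinity>"
    using emeasure_mono[OF assms(5), of M] by (auto simp: emeasure_ball top_unique)
  then have "(LINT u:S|M. (1::real)) = measure M S"
    using set_integral_const[OF assms(4), of "1::real"] by simp
  then show ?thesis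
    using sum_set_integral_le[OF assms(1,2), of S "\<lambda>_. 1"] assms(3,4)
      set_integrable_subset[OF const_integrable[of x r 1] assms(4,5)]
    by (simp add: set_integral_ball_const)
qed

text \<open>A packing argument: each member has radius at least \<open>e\<close> and its centre in
  \<open>ball x r\<close>, hence at least \<open>1 / D ^ k\<close> times the volume of
  \<open>ball x r\<close>. At most \<open>D ^ k\<close> disjoint members fit.\<close>

lemma disjoint_balls_finite:
  fixes x :: 'a
  assumes "disjoint_family_on (\<lambda>p. ball (fst p) (snd p)) J" "0 < e"
    and "\<And>p. p \<in> J \<Longrightarrow> e \<le> snd p \<and> ball (fst p) (snd p) \<subseteq> ball x r"
  shows "finite J"
proof (cases "0 < r")
  case False
  have "J = {}"
  proof (rule ccontr)
    assume "J \<noteq> {}"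
    then obtain p where "p \<in> J"
      by blast
    then have "fst p \<in> ball x r"
      using assms(2) assms(3)[of p] by (meson centre_in_ball less_le_trans subsetD)
    then show False
      using False by (simp add: ball_empty)
  qed
  then show ?thesis
    by simp
next
  case True
  obtain k :: nat where k: "2 * r / e < 2 ^ k"
    using real_arch_pow[of 2 "2 * r / e"] by auto
  define C where "C = nat \<lfloor>D ^ k\<rfloor>"
  \<comment> \<open>A uniform bound for finite subfamilies avoids sums over a family not yet known
    to be finite.\<close>
  have "card G \<le> C" if G: "G \<subseteq> J" "finite G" for G
  proof -
    have "vol x r \<le> D ^ k * vol (fst p) (snd p)" if "p \<in> G" for p
    proof (rule vol_compare)
      have "e \<le> snd p" and sub: "ball (fst p) (snd p) \<subseteq> ball x r"
        using assms(3)[of p] that G by blast+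
      then show "0 < snd p"
        using \<open>0 < e\<close> by linarith
      then have "fst p \<in> ball x r"
        using sub by (meson centre_in_ball subsetD)
      moreover have "2 * r \<le> 2 ^ k * e"
        using k \<open>0 < e\<close> by (simp add: field_simps)
      moreover have "2 ^ k * e \<le> 2 ^ k * snd p"
        using \<open>e \<le> snd p\<close> by simp
      ultimately show "dist x (fst p) + r \<le> 2 ^ k * snd p"
        unfolding mem_ball by linarith
    qed
    then have "real (card G) * vol x r \<le> (\<Sum>p\<in>G. D ^ k * vol (fst p) (snd p))"
      using sum_mono[of G "\<lambda>_. vol x r"] by simp
    also have "\<dots> = D ^ k * (\<Sum>p\<in>G. vol (fst p) (snd p))"
      by (simp add: sum_distrib_left)
    also have "\<dots> \<le> D ^ k * vol x r"
    proof (intro mult_left_mono sum_vol_le)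
      show "disjoint_family_on (\<lambda>p. ball (fst p) (snd p)) G"
        using assms(1) G(1) by (rule disjoint_family_on_mono[rotated])
      show "ball (fst p) (snd p) \<subseteq> ball x r" if "p \<in> G" for p
        using assms(3) G that by blast
    qed (use G D_ge_1 in auto)
    finally have "real (card G) \<le> D ^ k"
      using vol_pos[OF True, of x] by simp
    then show ?thesis
      unfolding C_def by linarith
  qed
  then show ?thesis
    using finite_if_finite_subsets_card_bdd by blast
qed

lemma nn_integral_ball_eq:
  assumes "f \<in> L1_loc M" "\<And>u. 0 \<le> f u" "0 < r"
  shows "(\<integral>\<^sup>+u\<in>ball x r. ennreal (f u) \<partial>M) = ennreal (avg f x r * vol x r)"
proof -
  have "(\<integral>\<^sup>+u\<in>ball x r. ennreal (f u) \<partial>M) = (\<integral>\<^sup>+u. ennreal (indicator (ball x r) u *\<^sub>R f u) \<partial>M)"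
    by (intro nn_integral_cong) (auto simp: indicator_def)
  also have "\<dots> = ennreal (LINT u:ball x r|M. f u)"
    unfolding set_lebesgue_integral_def
    using L1_loc_integrable[OF assms(1), of x r] assms(2)
    by (intro nn_integral_eq_integral) (auto simp: set_integrable_def)
  finally show ?thesis
    by (simp add: set_integral_eq_avg assms(3))
qed

text \<open>Suprema over open balls containing the point are lower semicontinuous.\<close>

lemma borel_measurable_SUP_balls [measurable]:
  fixes w :: "'a \<times> real \<Rightarrow> ennreal"
  shows "(\<lambda>y. SUP p\<in>{p. y \<in> ball (fst p) (snd p) \<and> P p}. w p) \<in> borel_measurable M"
proof (rule borel_measurableI_greater)
  fix a :: ennreal
  have "{y \<in> space M. a < (SUP p\<in>{p. y \<in> ball (fst p) (snd p) \<and> P p}. w p)}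
      = (\<Union>p\<in>{p. P p \<and> a < w p}. ball (fst p) (snd p))"
    by (auto simp: less_SUP_iff simp del: mem_ball split_paired_Ex)
  then show "{y \<in> space M. a < (SUP p\<in>{p. y \<in> ball (fst p) (snd p) \<and> P p}. w p)} \<in> sets M"
    by (auto intro!: sets_open)
qed

subsection \<open>The maximal function of the oscillation\<close>

text \<open>A positive cutoff \<open>e\<close> gives an a priori finite bound, while
  \<open>e = 0\<close> gives the full local maximal function; positivity of the radius is therefore
  a separate condition.\<close>

definition local_maximal :: "('a \<Rightarrow> real) \<Rightarrow> real \<Rightarrow> real \<Rightarrow> real \<Rightarrow> 'a \<Rightarrow> ennreal" where
  "local_maximal h c e R y =
     (SUP p\<in>{p. y \<in> ball (fst p) (snd p) \<and> (0 < snd p \<and> e \<le> snd p \<and> snd p \<le> R)}.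
        ennreal (avg (\<lambda>u. \<bar>h u - c\<bar>) (fst p) (snd p)))"

lemma local_maximal_measurable [measurable]: "local_maximal h c e R \<in> borel_measurable M"
  unfolding local_maximal_def by (rule borel_measurable_SUP_balls)

lemma local_maximal_leI:
  assumes "\<And>z r. dist z y < r \<Longrightarrow> 0 < r \<Longrightarrow> e \<le> r \<Longrightarrow> r \<le> R \<Longrightarrow>
    ennreal (avg (\<lambda>u. \<bar>h u - c\<bar>) z r) \<le> b"
  shows "local_maximal h c e R y \<le> b"
  unfolding local_maximal_def using assms by (intro SUP_least) auto

lemma local_maximal_ge:
  assumes "dist z y < r" "e \<le> r" "r \<le> R"
  shows "ennreal (avg (\<lambda>u. \<bar>h u - c\<bar>) z r) \<le> local_maximal h c e R y"
proof -
  have "0 < r"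
    using assms(1) by (meson le_less_trans zero_le_dist)
  then show ?thesis
    unfolding local_maximal_def using assms
    by (intro SUP_upper2[where i = "(z, r)"]) auto
qed

text \<open>All competing radii are comparable to \<open>R\<close>, so one comparison with
  \<open>ball x (3 * R)\<close> suffices. The exponent \<open>k\<close> grows as \<open>e\<close>
  tends to 0; the bound only has to be finite, as the start of an iteration.\<close>

lemma local_maximal_le:
  assumes h: "h \<in> L1_loc M" and "0 < R" and osc: "osc h x (3 * R) \<le> w"
    and y: "y \<in> ball x R" and k: "5 * R \<le> 2 ^ k * e" and w: "0 \<le> w" and "0 < e"
  shows "local_maximal h (avg h x (3 * R)) e R y \<le> ennreal (D ^ k * w)"
proof (rule local_maximal_leI)
  fix z r assume z: "dist z y < r" "0 < r" "e \<le> r" "r \<le> R"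
  have d: "dist z x < R + r"
    using y z(1) dist_triangle[of z x y] by (simp add: dist_commute)
  have "2 ^ k * e \<le> 2 ^ k * r"
    using z(3) by simp
  then have "5 * R \<le> 2 ^ k * r"
    using k by linarith
  then have "avg (\<lambda>u. \<bar>h u - avg h x (3 * R)\<bar>) z r \<le> D ^ k * osc h x (3 * R)"
    using d z \<open>0 < R\<close> by (intro avg_abs_diff_le_osc[OF h]) (auto simp: dist_commute)
  also have "\<dots> \<le> D ^ k * w"
    using osc D_ge_1 by (intro mult_left_mono) auto
  finally show "ennreal (avg (\<lambda>u. \<bar>h u - avg h x (3 * R)\<bar>) z r) \<le> ennreal (D ^ k * w)"
    by (rule ennreal_leI)
qed

text \<open>The constant is the average over the tripled ball because every ball of radius at most
  \<open>R\<close> that meets \<open>ball x R\<close> lies in it.\<close>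

abbreviation maximal_integral where
  "maximal_integral h e x R \<equiv> (\<integral>\<^sup>+y\<in>ball x R. local_maximal h (avg h x (3 * R)) e R y \<partial>M)"

lemma nn_integral_ball_le:
  assumes "\<And>y. y \<in> ball x R \<Longrightarrow> F y \<le> ennreal c" "0 \<le> c"
  shows "(\<integral>\<^sup>+y\<in>ball x R. F y \<partial>M) \<le> ennreal (c * vol x R)"
proof -
  have "(\<integral>\<^sup>+y\<in>ball x R. F y \<partial>M) \<le> (\<integral>\<^sup>+y. ennreal c * indicator (ball x R) y \<partial>M)"
    using assms(1) by (intro nn_integral_mono) (auto split: split_indicator)
  also have "\<dots> = ennreal (c * vol x R)"
    by (simp add: nn_integral_cmult_indicator emeasure_ball ennreal_mult assms(2))
  finally show ?thesis .
qed

text \<open>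
  The balls on which the average of \<open>\<bar>h - c\<bar>\<close> exceeds \<open>2 D\<^sup>5 w\<close> lie in enlarged balls of small
  total volume. The enlarged balls have radius at most \<open>R\<close>, so that the bound with constant \<open>A\<close> applies
  to them again.
\<close>

lemma maximal_integral_step:
  assumes h: "h \<in> L1_loc M" and w: "0 < w" and e: "0 < e" and R: "0 < R" and A: "0 \<le> A"
    and osc: "\<And>z r. 0 < r \<Longrightarrow> r \<le> 3 * R \<Longrightarrow> osc h z r \<le> w"
    and bound: "\<And>z r. 0 < r \<Longrightarrow> r \<le> R \<Longrightarrow> maximal_integral h e z r \<le> ennreal (A * vol z r)"
  shows "maximal_integral h e x R \<le> ennreal (((3 * D ^ 5 + D ^ 9) * w + A / 2) * vol x R)"
proof -
  define c where "c = avg h x (3 * R)"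
  \<comment> \<open>The factor \<open>D ^ 5\<close> keeps balls of radius above \<open>R / 5\<close>
    out of \<open>I\<close>; the factor 2 produces the term \<open>A / 2\<close>.\<close>
  define l where "l = 2 * D ^ 5 * w"
  define I where "I = {p. ball (fst p) (snd p) \<inter> ball x R \<noteq> {} \<and> e \<le> snd p \<and> snd p \<le> R \<and>
    l < avg (\<lambda>u. \<bar>h u - c\<bar>) (fst p) (snd p)}"
  have Dk: "1 \<le> D ^ k" for k
    using D_ge_1 by simp
  have l: "0 < l"
    using w D_ge_1 by (simp add: l_def)
  have I_sub: "dist x (fst p) < R + snd p" if "p \<in> I" for p
  proof -
    have "ball (fst p) (snd p) \<inter> ball x R \<noteq> {}"
      using that unfolding I_def by blast
    then obtain v where "v \<in> ball (fst p) (snd p)" "v \<in> ball x R"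
      by blast
    then show ?thesis
      using dist_triangle2[of x "fst p" v] unfolding mem_ball by linarith
  qed
  have I_pos: "0 < snd p" "snd p \<le> R" "e \<le> snd p" if "p \<in> I" for p
    using that e unfolding I_def by auto
  have I_small: "5 * snd p \<le> R" if p: "p \<in> I" for p
  proof (rule ccontr)
    assume large: "\<not> 5 * snd p \<le> R"
    \<comment> \<open>Five doublings suffice, since
      \<open>dist x (fst p) + 3 * R < 4 * R + snd p \<le> 2 ^ 5 * snd p\<close> when
      \<open>R < 5 * snd p\<close>.\<close>
    have "avg (\<lambda>u. \<bar>h u - c\<bar>) (fst p) (snd p) \<le> D ^ 5 * osc h x (3 * R)"
      unfolding c_def
      using I_sub[OF p] I_pos[OF p] R large
      by (intro avg_abs_diff_le_osc[OF h]) (auto simp: dist_commute)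
    also have "\<dots> \<le> D ^ 5 * w"
      using osc[of "3 * R" x] R D_ge_1 by (intro mult_left_mono) auto
    also have "\<dots> \<le> l"
      using w D_ge_1 by (simp add: l_def)
    finally show False
      using p by (simp add: I_def)
  qed
  obtain J where J: "J \<subseteq> I" and disj: "disjoint_family_on (\<lambda>p. ball (fst p) (snd p)) J"
    and cover: "\<And>p. p \<in> I \<Longrightarrow> \<exists>q\<in>J. snd p \<le> 2 * snd q \<and> ball (fst p) (snd p) \<subseteq> ball (fst q) (5 * snd q)"
    using Vitali_covering[of I R] I_pos by blast
  have J_I: "q \<in> I" if "q \<in> J" for q
    using J that by blast
  have J_ball: "ball (fst q) (snd q) \<subseteq> ball x (3 * R)" if "q \<in> J" for q
  proof (rule ball_subset)
    show "dist (fst q) x + snd q \<le> 3 * R"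
      using I_sub[OF J_I[OF that]] I_pos[OF J_I[OF that]] by (simp add: dist_commute)
  qed
  have finJ: "finite J"
    using disjoint_balls_finite[OF disj e, of x "3 * R"] J_ball I_pos(3)[OF J_I] by blast
  \<comment> \<open>Since \<open>15 = 3 * 5\<close>, this constant makes \<open>T q\<close> the
    integrand to which \<open>bound\<close> applies on the ball of radius
    \<open>5 * snd q\<close>.\<close>
  define m where "m = (\<lambda>q::'a \<times> real. avg h (fst q) (15 * snd q))"
  define T where "T = (\<lambda>q::'a \<times> real. local_maximal h (m q) e (5 * snd q))"
  define v where "v = (\<lambda>q::'a \<times> real. vol (fst q) (snd q))"
  have v5: "vol (fst q) (5 * snd q) \<le> D ^ 3 * v q" if "q \<in> J" for q
    unfolding v_def using I_pos[OF J_I[OF that]] by (intro vol_compare) auto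
  have v0: "0 \<le> v q" for q
    by (simp add: v_def)
  \<comment> \<open>An average above \<open>l\<close> comes from a ball in \<open>I\<close>. That
    ball lies in the enlargement of some \<open>q\<close> in \<open>J\<close> and has radius at most
    \<open>5 * snd q\<close>, so it competes in \<open>T q\<close> once \<open>c\<close> is replaced
    by \<open>m q\<close>.\<close>
  have pointwise: "local_maximal h c e R y \<le>
      ennreal l + (\<Sum>q\<in>J. (T q y + ennreal \<bar>m q - c\<bar>) * indicator (ball (fst q) (5 * snd q)) y)"
    (is "_ \<le> ennreal l + ?S") if y: "y \<in> ball x R" for y
  proof (rule local_maximal_leI)
    fix z r assume z: "dist z y < r" "0 < r" "e \<le> r" "r \<le> R"
    show "ennreal (avg (\<lambda>u. \<bar>h u - c\<bar>) z r) \<le> ennreal l + ?S"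
    proof (cases "avg (\<lambda>u. \<bar>h u - c\<bar>) z r \<le> l")
      case True
      then show ?thesis
        by (intro add_increasing2 ennreal_leI) auto
    next
      case False
      then have "(z, r) \<in> I"
        using z y unfolding I_def by auto
      then obtain q where q: "q \<in> J" "r \<le> 2 * snd q" "ball z r \<subseteq> ball (fst q) (5 * snd q)"
        using cover[of "(z, r)"] by auto
      have r5: "r \<le> 5 * snd q"
        using q(2) I_pos[OF J_I[OF q(1)]] by simp
      have yq: "y \<in> ball (fst q) (5 * snd q)"
        using q(3) z(1) by auto
      have "ennreal (avg (\<lambda>u. \<bar>h u - c\<bar>) z r) \<le> ennreal (avg (\<lambda>u. \<bar>h u - m q\<bar>) z r + \<bar>m q - c\<bar>)"
        by (intro ennreal_leI avg_abs_diff_triangle[OF h z(2)])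
      also have "\<dots> = ennreal (avg (\<lambda>u. \<bar>h u - m q\<bar>) z r) + ennreal \<bar>m q - c\<bar>"
        by (intro ennreal_plus) (auto intro: avg_nonneg)
      also have "\<dots> \<le> T q y + ennreal \<bar>m q - c\<bar>"
        unfolding T_def using z r5 by (intro add_right_mono local_maximal_ge) auto
      also have "\<dots> = (T q y + ennreal \<bar>m q - c\<bar>) * indicator (ball (fst q) (5 * snd q)) y"
        using yq by simp
      also have "\<dots> \<le> ?S"
        using finJ q(1) by (intro member_le_sum) auto
      finally show ?thesis
        by (intro add_increasing) auto
    qed
  qed
  have c_int: "set_integrable M (ball x (3 * R)) (\<lambda>u. \<bar>h u - c\<bar>)"
    by (rule L1_loc_integrable[OF L1_loc_abs_diff[OF h]])
  have "(\<Sum>q\<in>J. LINT u:ball (fst q) (snd q)|M. \<bar>h u - c\<bar>) \<le> (LINT u:ball x (3 * R)|M. \<bar>h u - c\<bar>)"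
    using sum_set_integral_le[OF finJ disj _ _ c_int] J_ball by simp
  also have "\<dots> = osc h x (3 * R) * vol x (3 * R)"
    using R unfolding c_def mean_oscillation_def by (subst set_integral_eq_avg) auto
  also have "\<dots> \<le> w * (D ^ 2 * vol x R)"
    using osc[of "3 * R" x] R osc_nonneg[of h x "3 * R"] w by (intro mult_mono vol_compare) auto
  also have "(\<Sum>q\<in>J. LINT u:ball (fst q) (snd q)|M. \<bar>h u - c\<bar>)
      = (\<Sum>q\<in>J. avg (\<lambda>u. \<bar>h u - c\<bar>) (fst q) (snd q) * v q)"
    unfolding v_def using I_pos(1)[OF J_I] by (intro sum.cong refl set_integral_eq_avg)
  finally have sum_avg: "(\<Sum>q\<in>J. avg (\<lambda>u. \<bar>h u - c\<bar>) (fst q) (snd q) * v q) \<le> w * (D ^ 2 * vol x R)" .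
  \<comment> \<open>Chebyshev's inequality over the disjoint balls of \<open>J\<close>. The
    resulting \<open>sum_v\<close> absorbs the factor \<open>D ^ 3\<close> lost in enlarging the
    balls by 5 and leaves a factor \<open>1 / 2\<close>.\<close>
  have "l * (\<Sum>q\<in>J. v q) \<le> (\<Sum>q\<in>J. avg (\<lambda>u. \<bar>h u - c\<bar>) (fst q) (snd q) * v q)"
    unfolding sum_distrib_left
  proof (intro sum_mono mult_right_mono v0)
    fix q assume "q \<in> J"
    then show "l \<le> avg (\<lambda>u. \<bar>h u - c\<bar>) (fst q) (snd q)"
      using J_I[of q] by (simp add: I_def)
  qed
  also note sum_avg
  finally have "w * (2 * D ^ 5 * (\<Sum>q\<in>J. v q)) \<le> w * (D ^ 2 * vol x R)"
    by (simp add: l_def mult_ac)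
  then have "2 * D ^ 5 * (\<Sum>q\<in>J. v q) \<le> D ^ 2 * vol x R"
    using w by simp
  then have "D ^ 2 * (2 * D ^ 3 * (\<Sum>q\<in>J. v q)) \<le> D ^ 2 * vol x R"
    by (simp add: power_numeral_reduce mult_ac)
  then have sum_v: "2 * D ^ 3 * (\<Sum>q\<in>J. v q) \<le> vol x R"
    using D_ge_1 by simp
  \<comment> \<open>The mean \<open>m q\<close> is compared with the mean over the selected ball
    itself, at the cost of \<open>15 \<le> 2 ^ 4\<close>, because \<open>sum_avg\<close> controls
    the averages of \<open>\<bar>h - c\<bar>\<close> over these disjoint balls.\<close>
  have m_diff: "\<bar>m q - c\<bar> * v q \<le> avg (\<lambda>u. \<bar>h u - c\<bar>) (fst q) (snd q) * v q + D ^ 4 * w * v q" if q: "q \<in> J" for q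
  proof -
    have s: "0 < snd q" "5 * snd q \<le> R"
      using I_pos[OF J_I[OF q]] I_small[OF J_I[OF q]] by auto
    have "\<bar>avg h (fst q) (snd q) - m q\<bar> \<le> D ^ 4 * osc h (fst q) (15 * snd q)"
      unfolding m_def using s by (intro abs_avg_diff_le_osc[OF h]) auto
    also have "\<dots> \<le> D ^ 4 * w"
      using s D_ge_1 by (intro mult_left_mono osc) auto
    finally have "\<bar>m q - c\<bar> \<le> avg (\<lambda>u. \<bar>h u - c\<bar>) (fst q) (snd q) + D ^ 4 * w"
      using abs_avg_diff_le[OF h s(1), of "fst q" c] by linarith
    from mult_right_mono[OF this v0[of q]] show ?thesis
      by (simp add: distrib_right)
  qed
  have sum_v': "(\<Sum>q\<in>J. v q) \<le> vol x R"
  proof -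
    have "1 * (\<Sum>q\<in>J. v q) \<le> (2 * D ^ 3) * (\<Sum>q\<in>J. v q)"
      using Dk[of 3] v0 by (intro mult_right_mono sum_nonneg) auto
    then show ?thesis
      using sum_v by simp
  qed
  have "(\<Sum>q\<in>J. \<bar>m q - c\<bar> * v q) \<le> (\<Sum>q\<in>J. avg (\<lambda>u. \<bar>h u - c\<bar>) (fst q) (snd q) * v q + D ^ 4 * w * v q)"
    by (intro sum_mono m_diff)
  also have "\<dots> \<le> w * (D ^ 2 * vol x R) + D ^ 4 * w * vol x R"
    unfolding sum.distrib sum_distrib_left[symmetric]
    using sum_avg sum_v' w D_ge_1 by (intro add_mono mult_left_mono) auto
  finally have sum_m: "(\<Sum>q\<in>J. \<bar>m q - c\<bar> * v q) \<le> w * (D ^ 2 * vol x R) + D ^ 4 * w * vol x R" .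
  have piece: "(\<integral>\<^sup>+y\<in>ball (fst q) (5 * snd q). (T q y + ennreal \<bar>m q - c\<bar>) \<partial>M)
      \<le> ennreal (D ^ 3 * (A * v q + \<bar>m q - c\<bar> * v q))" if q: "q \<in> J" for q
  proof -
    let ?B = "ball (fst q) (5 * snd q)"
    have s: "0 < snd q" "5 * snd q \<le> R"
      using I_pos[OF J_I[OF q]] I_small[OF J_I[OF q]] by auto
    have "(\<integral>\<^sup>+y\<in>?B. (T q y + ennreal \<bar>m q - c\<bar>) \<partial>M)
        = (\<integral>\<^sup>+y\<in>?B. T q y \<partial>M) + (\<integral>\<^sup>+y\<in>?B. ennreal \<bar>m q - c\<bar> \<partial>M)"
      unfolding distrib_right T_def by (intro nn_integral_add) auto
    also have "\<dots> \<le> ennreal (A * vol (fst q) (5 * snd q)) + ennreal (\<bar>m q - c\<bar> * vol (fst q) (5 * snd q))"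
    proof (rule add_mono)
      show "(\<integral>\<^sup>+y\<in>?B. T q y \<partial>M) \<le> ennreal (A * vol (fst q) (5 * snd q))"
        using bound[of "5 * snd q" "fst q"] s by (simp add: T_def m_def)
    qed (rule nn_integral_ball_le, auto)
    also have "\<dots> = ennreal ((A + \<bar>m q - c\<bar>) * vol (fst q) (5 * snd q))"
      using A by (subst ennreal_plus[symmetric]) (auto simp: distrib_right)
    also have "\<dots> \<le> ennreal ((A + \<bar>m q - c\<bar>) * (D ^ 3 * v q))"
      using v5[OF q] A by (intro ennreal_leI mult_left_mono) auto
    finally show ?thesis
      by (simp add: algebra_simps)
  qed
  have "maximal_integral h e x R \<le> (\<integral>\<^sup>+y. ennreal l * indicator (ball x R) y +
      (\<Sum>q\<in>J. (T q y + ennreal \<bar>m q - c\<bar>) * indicator (ball (fst q) (5 * snd q)) y) \<partial>M)"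
    using pointwise unfolding c_def[symmetric] by (intro nn_integral_mono) (auto split: split_indicator)
  also have "\<dots> = (\<integral>\<^sup>+y. ennreal l * indicator (ball x R) y \<partial>M) +
      (\<Sum>q\<in>J. \<integral>\<^sup>+y\<in>ball (fst q) (5 * snd q). (T q y + ennreal \<bar>m q - c\<bar>) \<partial>M)"
    unfolding T_def by (subst nn_integral_add) (auto intro!: nn_integral_sum)
  also have "\<dots> \<le> ennreal (l * vol x R) + (\<Sum>q\<in>J. ennreal (D ^ 3 * (A * v q + \<bar>m q - c\<bar> * v q)))"
    using l by (intro add_mono sum_mono piece nn_integral_ball_le) auto
  also have "\<dots> = ennreal (l * vol x R + (\<Sum>q\<in>J. D ^ 3 * (A * v q + \<bar>m q - c\<bar> * v q)))"
    using l A D_ge_1 v0 by (subst sum_ennreal) (auto simp: ennreal_plus[symmetric] sum_nonneg simp del: ennreal_plus)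
  also have "\<dots> \<le> ennreal (((3 * D ^ 5 + D ^ 9) * w + A / 2) * vol x R)"
  proof (rule ennreal_leI)
    have "(\<Sum>q\<in>J. D ^ 3 * (A * v q + \<bar>m q - c\<bar> * v q))
        = A / 2 * (2 * D ^ 3 * (\<Sum>q\<in>J. v q)) + D ^ 3 * (\<Sum>q\<in>J. \<bar>m q - c\<bar> * v q)"
      unfolding sum_distrib_left[symmetric] sum.distrib by (simp add: algebra_simps)
    also have "\<dots> \<le> A / 2 * vol x R + D ^ 3 * (w * (D ^ 2 * vol x R) + D ^ 4 * w * vol x R)"
      using A sum_v sum_m D_ge_1 by (intro add_mono mult_left_mono) auto
    also have "\<dots> = (A / 2 + (D ^ 5 + D ^ 7) * w) * vol x R"
      by (simp add: algebra_simps power_numeral_reduce)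
    \<comment> \<open>Raising the exponent 7 to 9 reaches the stated constant; the coefficient 3 of
      \<open>D ^ 5\<close> is 1 from here and 2 from \<open>l\<close>.\<close>
    also have "\<dots> \<le> (A / 2 + (D ^ 5 + D ^ 9) * w) * vol x R"
      using D_ge_1 w by (intro mult_right_mono add_left_mono) (auto intro: power_increasing)
    finally show "l * vol x R + (\<Sum>q\<in>J. D ^ 3 * (A * v q + \<bar>m q - c\<bar> * v q))
        \<le> ((3 * D ^ 5 + D ^ 9) * w + A / 2) * vol x R"
      by (simp add: l_def algebra_simps)
  qed
  finally show ?thesis .
qed

text \<open>One step sends the constant \<open>A\<close> to \<open>C / 2 + A / 2\<close>, where
  \<open>C\<close> is twice the coefficient in \<open>maximal_integral_step\<close>. Iterating from
  the crude bound for the cutoff \<open>e\<close> leads to the fixed point \<open>C\<close>, which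
  is free of \<open>e\<close>.\<close>

lemma maximal_integral_le_truncated:
  assumes h: "h \<in> L1_loc M" and w: "0 < w" and e: "0 < e" and R: "0 < R"
    and osc: "\<And>z r. 0 < r \<Longrightarrow> r \<le> 3 * R \<Longrightarrow> osc h z r \<le> w"
  shows "maximal_integral h e x R \<le> ennreal ((6 * D ^ 5 + 2 * D ^ 9) * w * vol x R)"
proof -
  obtain k :: nat where "5 * R / e < 2 ^ k"
    using real_arch_pow[of 2 "5 * R / e"] by auto
  then have k: "5 * R \<le> 2 ^ k * e"
    using e by (simp add: field_simps)
  define C where "C = (6 * D ^ 5 + 2 * D ^ 9) * w"
  define A where "A = D ^ k * w"
  have C: "0 \<le> C" "0 \<le> A"
    using w D_ge_1 by (auto simp: C_def A_def)
  \<comment> \<open>All balls of radius up to \<open>R\<close> are treated at once, because each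
    step uses the previous bound at other centres and smaller radii.\<close>
  have bound: "maximal_integral h e z r \<le> ennreal ((C + A / 2 ^ n) * vol z r)"
    if "0 < r" "r \<le> R" for n z r
    using that
  proof (induction n arbitrary: z r)
    case 0
    have "maximal_integral h e z r \<le> ennreal (A * vol z r)"
      unfolding A_def using 0 k w e D_ge_1 osc[of "3 * r" z]
      by (intro nn_integral_ball_le local_maximal_le[OF h]) auto
    also have "\<dots> \<le> ennreal ((C + A / 2 ^ 0) * vol z r)"
      using C by (intro ennreal_leI mult_right_mono) auto
    finally show ?case .
  next
    case (Suc n)
    have "maximal_integral h e z r \<le> ennreal (((3 * D ^ 5 + D ^ 9) * w + (C + A / 2 ^ n) / 2) * vol z r)"
      using Suc C by (intro maximal_integral_step[OF h w e] osc) auto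
    also have "((3 * D ^ 5 + D ^ 9) * w + (C + A / 2 ^ n) / 2) = C + A / 2 ^ Suc n"
      by (simp add: C_def field_simps)
    finally show ?case .
  qed
  have "(\<lambda>n. A / 2 ^ n) \<longlonglongrightarrow> 0"
    by (rule LIMSEQ_divide_realpow_zero) simp
  then have "(\<lambda>n. (C + A / 2 ^ n) * vol x R) \<longlonglongrightarrow> (C + 0) * vol x R"
    by (intro tendsto_intros)
  then have "(\<lambda>n. ennreal ((C + A / 2 ^ n) * vol x R)) \<longlonglongrightarrow> ennreal ((C + 0) * vol x R)"
    by (rule tendsto_ennrealI)
  then have "maximal_integral h e x R \<le> ennreal ((C + 0) * vol x R)"
    using bound[of R x] R by (intro LIMSEQ_le_const) auto
  then show ?thesis
    by (simp add: C_def)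
qed

lemma local_maximal_0_eq_SUP:
  "local_maximal h c 0 R y = (SUP n. local_maximal h c (inverse (real (Suc n))) R y)"
proof (rule antisym)
  show "local_maximal h c 0 R y \<le> (SUP n. local_maximal h c (inverse (real (Suc n))) R y)"
  proof (rule local_maximal_leI)
    fix z r assume z: "dist z y < r" "0 < r" "r \<le> R"
    obtain n where "inverse (real (Suc n)) < r"
      using reals_Archimedean[OF z(2)] by blast
    then have "ennreal (avg (\<lambda>u. \<bar>h u - c\<bar>) z r) \<le> local_maximal h c (inverse (real (Suc n))) R y"
      using z by (intro local_maximal_ge) auto
    then show "ennreal (avg (\<lambda>u. \<bar>h u - c\<bar>) z r) \<le> (SUP n. local_maximal h c (inverse (real (Suc n))) R y)"
      by (rule SUP_upper2[OF UNIV_I])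
  qed
next
  show "(SUP n. local_maximal h c (inverse (real (Suc n))) R y) \<le> local_maximal h c 0 R y"
    by (intro SUP_least local_maximal_leI local_maximal_ge) auto
qed

text \<open>Monotone convergence as the cutoff tends to 0; the truncated bound is the same for every
  cutoff.\<close>

lemma maximal_integral_le:
  assumes h: "h \<in> L1_loc M" and w: "0 \<le> w" and R: "0 < R"
    and osc: "\<And>z r. 0 < r \<Longrightarrow> r \<le> 3 * R \<Longrightarrow> osc h z r \<le> w"
  shows "maximal_integral h 0 x R \<le> ennreal ((6 * D ^ 5 + 2 * D ^ 9) * w * vol x R)"
proof -
  define C where "C = 6 * D ^ 5 + 2 * D ^ 9"
  have C: "0 < C"
    using D_ge_1 by (simp add: C_def add_pos_pos)
  let ?T = "\<lambda>n. local_maximal h (avg h x (3 * R)) (inverse (real (Suc n))) R"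
  have eq: "maximal_integral h 0 x R = (SUP n. maximal_integral h (inverse (real (Suc n))) x R)"
  proof -
    have "maximal_integral h 0 x R = (\<integral>\<^sup>+y. (SUP n. ?T n y * indicator (ball x R) y) \<partial>M)"
      by (simp add: local_maximal_0_eq_SUP SUP_mult_right_ennreal)
    also have "\<dots> = (SUP n. maximal_integral h (inverse (real (Suc n))) x R)"
    proof (rule nn_integral_monotone_convergence_SUP)
      have "?T m y \<le> ?T n y" if "m \<le> n" for m n y
      proof (intro local_maximal_leI local_maximal_ge)
        fix r assume "inverse (real (Suc m)) \<le> r"
        moreover have "inverse (real (Suc n)) \<le> inverse (real (Suc m))"
          using that by (intro le_imp_inverse_le) auto
        ultimately show "inverse (real (Suc n)) \<le> r"
          by linarith
      qed
      then show "incseq (\<lambda>n y. ?T n y * indicator (ball x R) y)"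
        by (intro monoI le_funI mult_right_mono) auto
    qed simp
    finally show ?thesis .
  qed
  show ?thesis
  proof (rule ennreal_le_epsilon)
    fix d :: real assume d: "0 < d"
    \<comment> \<open>The truncated estimate asks for a positive bound on the oscillation, whereas
      \<open>w = 0\<close> is allowed here. The increment raises the final bound by exactly
      \<open>d\<close>.\<close>
    define w' where "w' = w + d / (C * vol x R)"
    have w': "w < w'"
      using C d vol_pos[OF R, of x] by (simp add: w'_def)
    have "osc h z r \<le> w'" if "0 < r" "r \<le> 3 * R" for z r
      using osc[OF that, of z] w' by linarith
    then have "maximal_integral h (inverse (real (Suc n))) x R \<le> ennreal (C * w' * vol x R)" for n
      unfolding C_def using w w' by (intro maximal_integral_le_truncated[OF h _ _ R]) auto
    then have "maximal_integral h 0 x R \<le> ennreal (C * w' * vol x R)"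
      unfolding eq by (rule SUP_least)
    also have "C * w' * vol x R = C * w * vol x R + d"
    proof -
      have "C \<noteq> 0" "vol x R \<noteq> 0"
        using C vol_pos[OF R, of x] by auto
      then show ?thesis
        by (simp add: w'_def distrib_left distrib_right)
    qed
    also have "ennreal (C * w * vol x R + d) = ennreal (C * w * vol x R) + ennreal d"
      using C w d by (intro ennreal_plus) auto
    finally show "maximal_integral h 0 x R \<le> ennreal ((6 * D ^ 5 + 2 * D ^ 9) * w * vol x R) + ennreal d"
      by (simp add: C_def)
  qed
qed

subsection \<open>The fractional maximal function\<close>

lemma diameter_pos:
  assumes "bounded (UNIV :: 'a set)"
  shows "0 < diameter (UNIV :: 'a set)"
proof -
  obtain x y :: 'a where "x \<noteq> y"
    using more_than_one_point by blast
  then show ?thesis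
    using diameter_bounded_bound[OF assms, of x y] by (meson UNIV_I less_le_trans zero_less_dist_iff)
qed

lemma ball_eq_UNIV:
  assumes "bounded (UNIV :: 'a set)" "diameter (UNIV :: 'a set) < r"
  shows "ball (x::'a) r = UNIV"
  using diameter_bounded_bound[OF assms(1), of x] assms(2)
  by (metis UNIV_I UNIV_eq_I le_less_trans mem_ball)

lemma less_two_ediam_iff:
  "ereal r < 2 * ediam (UNIV :: 'a set) \<longleftrightarrow>
    \<not> bounded (UNIV :: 'a set) \<or> r < 2 * diameter (UNIV :: 'a set)"
  by (auto simp: ediam_def)

lemma frac_maximal_eq:
  assumes "f \<in> L1_loc M"
  shows "frac_maximal M \<alpha> f y =
    (SUP p\<in>{p. y \<in> ball (fst p) (snd p) \<and> (0 < snd p \<and> ereal (snd p) < 2 * ediam (UNIV :: 'a set))}.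
      ennreal (snd p powr \<alpha> * avg (\<lambda>u. \<bar>f u\<bar>) (fst p) (snd p)))"
  unfolding frac_maximal_def
proof (rule SUP_cong)
  fix p :: "'a \<times> real"
  assume "p \<in> {p. y \<in> ball (fst p) (snd p) \<and> (0 < snd p \<and> ereal (snd p) < 2 * ediam (UNIV :: 'a set))}"
  then have p: "0 < snd p"
    by simp
  have "(\<integral>\<^sup>+u\<in>ball (fst p) (snd p). ennreal \<bar>f u\<bar> \<partial>M) / emeasure M (ball (fst p) (snd p))
      = ennreal (avg (\<lambda>u. \<bar>f u\<bar>) (fst p) (snd p))"
    using nn_integral_ball_eq[OF L1_loc_abs[OF assms] _ p, of "fst p"] vol_pos[OF p, of "fst p"]
    by (simp add: emeasure_ball divide_ennreal avg_nonneg)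
  then show "(case p of (z, r) \<Rightarrow> ennreal (r powr \<alpha>) *
      ((\<integral>\<^sup>+u\<in>ball z r. ennreal \<bar>f u\<bar> \<partial>M) / emeasure M (ball z r)))
      = ennreal (snd p powr \<alpha> * avg (\<lambda>u. \<bar>f u\<bar>) (fst p) (snd p))"
    by (simp add: case_prod_beta ennreal_mult avg_nonneg)
qed auto

lemma frac_maximal_measurable:
  assumes "f \<in> L1_loc M"
  shows "frac_maximal M \<alpha> f \<in> borel_measurable M"
  unfolding frac_maximal_eq[OF assms, abs_def] by (rule borel_measurable_SUP_balls)

lemma frac_maximal_leI:
  assumes "f \<in> L1_loc M"
    and "\<And>z r. dist z y < r \<Longrightarrow> 0 < r \<Longrightarrow> ereal r < 2 * ediam (UNIV :: 'a set) \<Longrightarrow>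
      ennreal (r powr \<alpha> * avg (\<lambda>u. \<bar>f u\<bar>) z r) \<le> b"
  shows "frac_maximal M \<alpha> f y \<le> b"
  unfolding frac_maximal_eq[OF assms(1)] using assms(2) by (intro SUP_least) auto

text \<open>
  If \<open>s\<close> is too large to compete in the supremum, then the ball of radius \<open>s\<close> is the whole space
  and coincides with an admissible ball.
\<close>

lemma frac_maximal_ge:
  assumes f: "f \<in> L1_loc M" and \<alpha>: "0 \<le> \<alpha>" and x: "dist z x < s"
    and r: "0 < r" "r \<le> s" "ereal r < 2 * ediam (UNIV :: 'a set)"
  shows "ennreal (r powr \<alpha> * avg (\<lambda>u. \<bar>f u\<bar>) z s) \<le> frac_maximal M \<alpha> f x"
proof -
  have admissible: "ennreal (r powr \<alpha> * avg (\<lambda>u. \<bar>f u\<bar>) z t) \<le> frac_maximal M \<alpha> f x"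
    if "dist z x < t" "r \<le> t" "ereal t < 2 * ediam (UNIV :: 'a set)" for t
  proof -
    have "r powr \<alpha> * avg (\<lambda>u. \<bar>f u\<bar>) z t \<le> t powr \<alpha> * avg (\<lambda>u. \<bar>f u\<bar>) z t"
      using r that \<alpha> by (intro mult_right_mono powr_mono2 avg_nonneg) auto
    then show ?thesis
      unfolding frac_maximal_eq[OF f] using that r
      by (intro SUP_upper2[where i = "(z, t)"]) (auto intro: ennreal_leI)
  qed
  show ?thesis
  proof (cases "ereal s < 2 * ediam (UNIV :: 'a set)")
    case True
    then show ?thesis
      using admissible x r by blast
  next
    case False
    define d where "d = diameter (UNIV :: 'a set)"
    have bdd: "bounded (UNIV :: 'a set)" and s: "2 * d \<le> s"
      using False unfolding less_two_ediam_iff d_def by auto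
    have d: "0 < d"
      unfolding d_def by (rule diameter_pos[OF bdd])
    \<comment> \<open>A radius at least \<open>r\<close> and strictly between \<open>d\<close> and
      \<open>2 * d\<close>: large enough for the ball to be the whole space, small enough to be
      admissible.\<close>
    define t where "t = max r (3 / 2 * d)"
    have t: "d < t" "t < 2 * d" "r \<le> t"
      using d r(3) bdd unfolding t_def less_two_ediam_iff d_def[symmetric] by auto
    have UNIV: "ball z t = UNIV" "ball z s = UNIV"
      using ball_eq_UNIV[OF bdd] t s d unfolding d_def by auto
    have "x \<in> ball z t"
      by (simp add: UNIV(1) del: mem_ball)
    moreover have "ereal t < 2 * ediam (UNIV :: 'a set)"
      unfolding less_two_ediam_iff using t(2) by (simp add: d_def)
    ultimately have "ennreal (r powr \<alpha> * avg (\<lambda>u. \<bar>f u\<bar>) z t) \<le> frac_maximal M \<alpha> f x"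
      using t(3) admissible by simp
    then show ?thesis
      by (simp only: UNIV)
  qed
qed

section \<open>Comparing the maximal function at two points of a ball\<close>

context
  fixes f :: "'a \<Rightarrow> real" and \<alpha> K :: real
  assumes f: "f \<in> L1_loc M" and \<alpha>: "0 \<le> \<alpha>" and K: "0 \<le> K"
    and powr_le_K: "\<And>r. 0 < r \<Longrightarrow> ereal r < 2 * ediam (UNIV :: 'a set) \<Longrightarrow> r powr \<alpha> \<le> K"
begin

abbreviation absf where "absf \<equiv> (\<lambda>u. \<bar>f u\<bar>)"

text \<open>The error depends on \<open>y\<close> alone, so that the infimum over \<open>x\<close>
  can be taken afterwards. \<open>\<theta>\<close> is the loss when a ball of radius above
  \<open>N * r0\<close> is enlarged so as to contain \<open>x\<close>.\<close>

lemma frac_maximal_pointwise: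
  assumes xy: "x \<in> ball x0 r0" "y \<in> ball x0 r0" and N: "1 \<le> N" and \<theta>: "0 \<le> \<theta>"
    and large: "\<And>z r. N * r0 < r \<Longrightarrow> avg absf z r \<le> avg absf z (r + 2 * r0) + \<theta>"
  shows "frac_maximal M \<alpha> f y \<le> frac_maximal M \<alpha> f x +
    (ennreal (K * \<theta>) + ennreal K * local_maximal absf (avg absf x0 (3 * (N * r0))) 0 (N * r0) y)"
    (is "_ \<le> _ + (_ + ennreal K * local_maximal _ ?c _ _ _)")
proof (rule frac_maximal_leI[OF f])
  fix z r assume z: "dist z y < r" "0 < r" and r: "ereal r < 2 * ediam (UNIV :: 'a set)"
  have rK: "0 \<le> r powr \<alpha>" "r powr \<alpha> \<le> K"
    using powr_le_K[OF z(2) r] by auto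
  have dx: "dist x0 x < r0" and dy: "dist x0 y < r0"
    using xy by auto
  have r0: "0 < r0"
    using dx by (meson le_less_trans zero_le_dist)
  have Nr0: "r0 \<le> N * r0"
    using N r0 by simp
  show "ennreal (r powr \<alpha> * avg absf z r) \<le> frac_maximal M \<alpha> f x +
      (ennreal (K * \<theta>) + ennreal K * local_maximal absf ?c 0 (N * r0) y)"
  proof (cases "r \<le> N * r0")
    case True
    let ?a = "avg (\<lambda>u. \<bar>absf u - ?c\<bar>) z r"
    have "avg absf z r \<le> ?c + ?a"
      using abs_avg_diff_le[OF L1_loc_abs[OF f] z(2), of z ?c] by linarith
    then have "r powr \<alpha> * avg absf z r \<le> r powr \<alpha> * ?c + r powr \<alpha> * ?a"
      using rK(1) by (simp add: distrib_left[symmetric] mult_left_mono)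
    also have "r powr \<alpha> * ?a \<le> K * ?a"
      using rK by (intro mult_right_mono avg_nonneg) auto
    finally have "ennreal (r powr \<alpha> * avg absf z r) \<le> ennreal (r powr \<alpha> * ?c + K * ?a)"
      by (intro ennreal_leI) simp
    also have "\<dots> = ennreal (r powr \<alpha> * ?c) + ennreal K * ennreal ?a"
    proof -
      have "0 \<le> ?a" "0 \<le> ?c"
        by (auto intro: avg_nonneg)
      then have "0 \<le> K * ?a" "0 \<le> r powr \<alpha> * ?c"
        using K rK(1) by (auto intro: mult_nonneg_nonneg)
      then show ?thesis
        using ennreal_mult[OF K \<open>0 \<le> ?a\<close>] by (simp only: ennreal_plus)
    qed
    also have "\<dots> \<le> frac_maximal M \<alpha> f x + ennreal K * local_maximal absf ?c 0 (N * r0) y"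
    proof (intro add_mono mult_left_mono)
      \<comment> \<open>\<open>ball x0 (3 * (N * r0))\<close> contains \<open>x\<close> and its
        radius is at least \<open>r\<close>, so the weight \<open>r powr \<alpha>\<close> is
        permitted by \<open>frac_maximal_ge\<close>.\<close>
      show "ennreal (r powr \<alpha> * ?c) \<le> frac_maximal M \<alpha> f x"
      proof (rule frac_maximal_ge[OF f \<alpha>])
        show "dist x0 x < 3 * (N * r0)" "r \<le> 3 * (N * r0)"
          using dx Nr0 r0 True by linarith+
      qed (rule z(2), rule r)
      show "ennreal ?a \<le> local_maximal absf ?c 0 (N * r0) y"
        using z True by (intro local_maximal_ge) auto
    qed simp
    also have "\<dots> \<le> frac_maximal M \<alpha> f x + (ennreal (K * \<theta>) + ennreal K * local_maximal absf ?c 0 (N * r0) y)"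
      by (intro add_left_mono) (simp add: add_increasing)
    finally show ?thesis .
  next
    case False
    have "r powr \<alpha> * avg absf z r \<le> r powr \<alpha> * avg absf z (r + 2 * r0) + r powr \<alpha> * \<theta>"
      using large[of r z] False rK(1) by (simp add: distrib_left[symmetric] mult_left_mono)
    also have "r powr \<alpha> * \<theta> \<le> K * \<theta>"
      using rK \<theta> by (intro mult_right_mono) auto
    finally have "ennreal (r powr \<alpha> * avg absf z r) \<le> ennreal (r powr \<alpha> * avg absf z (r + 2 * r0) + K * \<theta>)"
      by (intro ennreal_leI) simp
    also have "\<dots> = ennreal (r powr \<alpha> * avg absf z (r + 2 * r0)) + ennreal (K * \<theta>)"
      using rK(1) by (intro ennreal_plus mult_nonneg_nonneg avg_nonneg K \<theta>) auto
    also have "\<dots> \<le> frac_maximal M \<alpha> f x + ennreal (K * \<theta>)"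
    proof (intro add_right_mono frac_maximal_ge[OF f \<alpha>])
      show "dist z x < r + 2 * r0"
        using dx dy z(1) dist_triangle[of z x y] dist_triangle3[of y x x0] by linarith
    qed (use z r r0 in auto)
    also have "\<dots> \<le> frac_maximal M \<alpha> f x + (ennreal (K * \<theta>) + ennreal K * local_maximal absf ?c 0 (N * r0) y)"
      by (intro add_left_mono) (simp add: add_increasing2)
    finally show ?thesis .
  qed
qed

text \<open>By the pointwise comparison, values in the ball exceed the value at any other of its
  points by at most an integrable function \<open>b\<close>. Hence one point of finiteness gives
  finiteness almost everywhere, and the integral of \<open>b\<close> bounds the excess over the
  infimum \<open>m\<close>.\<close>

lemma frac_maximal_oscillation:
  assumes r0: "0 < r0" and \<theta>: "0 \<le> \<theta>" and w: "0 \<le> w"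
    and large: "\<And>z r. 2 ^ k * r0 < r \<Longrightarrow> avg absf z r \<le> avg absf z (r + 2 * r0) + \<theta>"
    and osc: "\<And>z r. 0 < r \<Longrightarrow> r \<le> 3 * (2 ^ k * r0) \<Longrightarrow> osc absf z r \<le> w"
    and fin: "x1 \<in> ball x0 r0" "frac_maximal M \<alpha> f x1 \<noteq> \<infinity>"
  shows "AE y in M. y \<in> ball x0 r0 \<longrightarrow> frac_maximal M \<alpha> f y < \<infinity>"
    and "\<exists>m\<ge>0. (\<forall>y\<in>ball x0 r0. frac_maximal M \<alpha> f y < \<infinity> \<longrightarrow> m \<le> enn2real (frac_maximal M \<alpha> f y)) \<and>
      (\<integral>\<^sup>+y\<in>ball x0 r0. ennreal (enn2real (frac_maximal M \<alpha> f y) - m) \<partial>M)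
        \<le> ennreal (K * (\<theta> + (6 * D ^ 5 + 2 * D ^ 9) * D ^ k * w) * vol x0 r0)"
proof -
  let ?F = "frac_maximal M \<alpha> f"
  define C where "C = 6 * D ^ 5 + 2 * D ^ 9"
  have C: "0 \<le> C"
    using D_ge_1 by (simp add: C_def)
  define T where "T = local_maximal absf (avg absf x0 (3 * (2 ^ k * r0))) 0 (2 ^ k * r0)"
  define b where "b = (\<lambda>y. ennreal (K * \<theta>) + ennreal K * T y)"
  have [measurable]: "T \<in> borel_measurable M" "b \<in> borel_measurable M"
    by (simp_all add: T_def b_def)
  have pointwise: "?F y \<le> ?F x + b y" if "x \<in> ball x0 r0" "y \<in> ball x0 r0" for x y
    unfolding b_def T_def using that \<theta> large by (intro frac_maximal_pointwise) auto
  \<comment> \<open>\<open>maximal_integral_le\<close> needs the domain to have the same radius as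
    the largest competing balls; enlarging the domain accordingly costs the factor
    \<open>D ^ k\<close>.\<close>
  have "(\<integral>\<^sup>+y\<in>ball x0 r0. T y \<partial>M) \<le> (\<integral>\<^sup>+y\<in>ball x0 (2 ^ k * r0). T y \<partial>M)"
  proof (rule nn_set_integral_set_mono)
    show "ball x0 r0 \<subseteq> ball x0 (2 ^ k * r0)"
      using r0 by (intro subset_ball) simp
  qed
  also have "\<dots> \<le> ennreal (C * w * vol x0 (2 ^ k * r0))"
    unfolding T_def C_def using r0 osc by (intro maximal_integral_le L1_loc_abs f w) auto
  also have "\<dots> \<le> ennreal (C * w * (D ^ k * vol x0 r0))"
    using C w r0 by (intro ennreal_leI mult_left_mono vol_doubling_power) auto
  finally have int_T: "(\<integral>\<^sup>+y\<in>ball x0 r0. T y \<partial>M) \<le> ennreal (C * w * (D ^ k * vol x0 r0))" .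
  have "(\<integral>\<^sup>+y\<in>ball x0 r0. b y \<partial>M)
      = (\<integral>\<^sup>+y\<in>ball x0 r0. ennreal (K * \<theta>) \<partial>M) + ennreal K * (\<integral>\<^sup>+y\<in>ball x0 r0. T y \<partial>M)"
    unfolding b_def distrib_right mult.assoc
    by (subst nn_integral_add) (auto simp: nn_integral_cmult)
  also have "\<dots> \<le> ennreal (K * \<theta> * vol x0 r0) + ennreal K * ennreal (C * w * (D ^ k * vol x0 r0))"
    using K \<theta> int_T by (intro add_mono nn_integral_ball_le mult_left_mono) auto
  also have "\<dots> = ennreal (K * \<theta> * vol x0 r0 + K * (C * w * (D ^ k * vol x0 r0)))"
    using K \<theta> C w D_ge_1 by (subst ennreal_plus) (auto simp: ennreal_mult)
  also have "K * \<theta> * vol x0 r0 + K * (C * w * (D ^ k * vol x0 r0)) = K * (\<theta> + C * D ^ k * w) * vol x0 r0"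
    by (simp add: algebra_simps)
  finally have int_b: "(\<integral>\<^sup>+y\<in>ball x0 r0. b y \<partial>M) \<le> ennreal (K * (\<theta> + C * D ^ k * w) * vol x0 r0)" .
  have "AE y in M. b y * indicator (ball x0 r0) y \<noteq> \<infinity>"
    using int_b by (intro nn_integral_PInf_AE) (auto simp: top_unique)
  then show "AE y in M. y \<in> ball x0 r0 \<longrightarrow> ?F y < \<infinity>"
  proof eventually_elim
    case (elim y)
    show ?case
    proof
      assume y: "y \<in> ball x0 r0"
      then have "b y < \<infinity>"
        using elim by (simp add: less_top)
      then show "?F y < \<infinity>"
        using pointwise[OF fin(1) y] fin(2) by (auto simp: less_top[symmetric] top_unique)
    qed
  qed
  \<comment> \<open>The infimum runs over all points of the ball, so every finite value is at least
    \<open>m\<close>; the point \<open>x1\<close> makes it finite.\<close>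
  define i where "i = (INF x\<in>ball x0 r0. ?F x)"
  define m where "m = enn2real i"
  have "i \<le> ?F x1"
    unfolding i_def using fin(1) by (rule INF_lower)
  then have i: "i = ennreal m"
    using fin(2) by (auto simp: m_def less_top[symmetric] top_unique intro!: ennreal_enn2real[symmetric])
  \<comment> \<open>If \<open>?F y\<close> is infinite, \<open>enn2real\<close> returns 0 and the
    left-hand side vanishes. Otherwise \<open>b y\<close> is moved to the left, so that the bound
    passes to the infimum over \<open>x\<close>.\<close>
  have le: "ennreal (enn2real (?F y) - m) \<le> b y" if y: "y \<in> ball x0 r0" for y
  proof (cases "?F y = \<infinity>")
    case True
    then show ?thesis
      by (simp add: m_def ennreal_neg)
  next
    case False
    have "?F y - b y \<le> i"
      unfolding i_def
    proof (rule INF_greatest)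
      fix x assume "x \<in> ball x0 r0"
      then show "?F y - b y \<le> ?F x"
        using pointwise[OF _ y, of x] False by (simp add: ennreal_minus_le_iff add.commute)
    qed
    then have "?F y \<le> b y + i"
      using False by (simp add: ennreal_minus_le_iff)
    moreover have "?F y = ennreal (enn2real (?F y))"
      using False by (simp add: less_top)
    ultimately have "ennreal (enn2real (?F y)) \<le> b y + ennreal m"
      using i by simp
    then have "ennreal (enn2real (?F y)) - ennreal m \<le> b y"
      by (simp add: ennreal_minus_le_iff add.commute)
    then show ?thesis
      by (simp add: ennreal_minus m_def)
  qed
  have "(\<integral>\<^sup>+y\<in>ball x0 r0. ennreal (enn2real (?F y) - m) \<partial>M) \<le> (\<integral>\<^sup>+y\<in>ball x0 r0. b y \<partial>M)"
    using le by (intro nn_integral_mono) (auto split: split_indicator)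
  also note int_b
  finally have int_m: "(\<integral>\<^sup>+y\<in>ball x0 r0. ennreal (enn2real (?F y) - m) \<partial>M)
      \<le> ennreal (K * (\<theta> + C * D ^ k * w) * vol x0 r0)" .
  have "m \<le> enn2real (?F y)" if "y \<in> ball x0 r0" "?F y < \<infinity>" for y
    unfolding m_def i_def using that by (intro enn2real_mono INF_lower) auto
  then show "\<exists>m\<ge>0. (\<forall>y\<in>ball x0 r0. ?F y < \<infinity> \<longrightarrow> m \<le> enn2real (?F y)) \<and>
      (\<integral>\<^sup>+y\<in>ball x0 r0. ennreal (enn2real (?F y) - m) \<partial>M)
        \<le> ennreal (K * (\<theta> + (6 * D ^ 5 + 2 * D ^ 9) * D ^ k * w) * vol x0 r0)"
    using int_m by (intro exI[of _ m]) (simp add: m_def C_def)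
qed

end

subsection \<open>Averages over concentric balls\<close>

text \<open>The value of \<open>\<theta>\<close> without annular decay:
  \<open>r + 2 * r0 < 3 * r\<close>, so two doublings suffice. This bound does not shrink as
  \<open>r / r0\<close> grows, which is enough for BLO.\<close>

lemma avg_le_enlarged_avg:
  assumes "h \<in> L1_loc M" "0 < r0" "r0 < r" and W: "\<And>z r. 0 < r \<Longrightarrow> osc h z r \<le> W"
  shows "avg h z r \<le> avg h z (r + 2 * r0) + D ^ 2 * W"
proof -
  have "\<bar>avg h z r - avg h z (r + 2 * r0)\<bar> \<le> D ^ 2 * osc h z (r + 2 * r0)"
    using assms by (intro abs_avg_diff_le_osc) auto
  also have "\<dots> \<le> D ^ 2 * W"
    using assms D_ge_1 by (intro mult_left_mono W) auto
  finally show ?thesis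
    by linarith
qed

text \<open>Telescoping over \<open>i\<close> doublings. The growth is only linear in
  \<open>i\<close>, which the geometric decay of thin annuli outweighs.\<close>

lemma avg_chain:
  assumes h: "h \<in> L1_loc M" and s: "0 < s" and W: "\<And>z r. 0 < r \<Longrightarrow> osc h z r \<le> W"
  shows "\<bar>avg h y s - avg h y (2 ^ i * s)\<bar> \<le> real i * (D * W)"
proof (induction i)
  case (Suc i)
  have "\<bar>avg h y (2 ^ i * s) - avg h y (2 ^ Suc i * s)\<bar> \<le> D ^ 1 * osc h y (2 ^ Suc i * s)"
    using s by (intro abs_avg_diff_le_osc[OF h]) auto
  also have "\<dots> \<le> D * W"
    using s D_ge_1 W[of "2 ^ Suc i * s" y] by simp
  finally show ?case
    using Suc by (simp add: distrib_right)
qed simp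

lemma set_integral_le_sum_cover:
  fixes f :: "'a \<Rightarrow> real"
  assumes "finite J" "S \<in> sets M" "S \<subseteq> (\<Union>j\<in>J. A j)" "\<And>u. 0 \<le> f u"
    and A: "\<And>j. j \<in> J \<Longrightarrow> A j \<in> sets M \<and> set_integrable M (A j) f"
  shows "(LINT u:S|M. f u) \<le> (\<Sum>j\<in>J. LINT u:A j|M. f u)"
proof -
  have "set_integrable M (\<Union>j\<in>J. A j) f"
    using assms(1) A by (intro set_integrable_UN) auto
  then have "set_integrable M S f"
    using assms(2,3) by (rule set_integrable_subset)
  have "(LINT u:S|M. f u) \<le> (LINT u|M. (\<Sum>j\<in>J. indicat_real (A j) u *\<^sub>R f u))"
    unfolding set_lebesgue_integral_def
  proof (rule integral_mono)
    show "integrable M (\<lambda>u. indicat_real S u *\<^sub>R f u)"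
      using \<open>set_integrable M S f\<close> by (simp add: set_integrable_def)
    show "integrable M (\<lambda>u. \<Sum>j\<in>J. indicat_real (A j) u *\<^sub>R f u)"
      using A by (intro Bochner_Integration.integrable_sum) (auto simp: set_integrable_def)
    show "indicat_real S u *\<^sub>R f u \<le> (\<Sum>j\<in>J. indicat_real (A j) u *\<^sub>R f u)" for u
    proof (cases "u \<in> S")
      case True
      then obtain j where j: "j \<in> J" "u \<in> A j"
        using assms(3) by blast
      have "indicat_real (A j) u *\<^sub>R f u \<le> (\<Sum>j\<in>J. indicat_real (A j) u *\<^sub>R f u)"
        using assms(1,4) j by (intro member_le_sum) auto
      then show ?thesis
        using True j by simp
    qed (use assms(4) in \<open>auto intro!: sum_nonneg\<close>)
  qed
  also have "\<dots> = (\<Sum>j\<in>J. LINT u:A j|M. f u)"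
    unfolding set_lebesgue_integral_def
    using A by (intro Bochner_Integration.integral_sum) (auto simp: set_integrable_def)
  finally show ?thesis .
qed

text \<open>
  The annulus \<open>ball z (r + 2 r\<^sub>0) - ball z r\<close> is covered by balls of radius comparable to \<open>r / 2\<^sup>k\<close>.
  On each of them the averages of \<open>h\<close> change by at most \<open>O(k W)\<close> up to scale \<open>r\<close>, and annular decay makes
  their total volume at most \<open>O(2\<^sup>-\<^sup>k\<^sup>\<beta>)\<close> times that of \<open>ball z r\<close>.
\<close>

lemma avg_le_enlarged_avg_annular_decay:
  assumes h: "h \<in> L1_loc M" and r0: "0 < r0" and r: "2 ^ k * r0 < r" and k: "1 \<le> k"
    and W: "\<And>z r. 0 < r \<Longrightarrow> osc h z r \<le> W"
    and \<beta>: "0 < \<beta>" and C: "0 \<le> C"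
    and decay: "\<And>x r R. 0 < r \<Longrightarrow> r \<le> R \<Longrightarrow>
      measure M (ball x R - ball x r) \<le> C * ((R - r) / R) powr \<beta> * vol x R"
  shows "avg h z r \<le> avg h z (r + 2 * r0) +
    (1 + real (k + 1) * D + D ^ 4) * W * (D ^ 3 * (C * (4 / 2 ^ k) powr \<beta> * D ^ 2))"
proof -
  define R where "R = r + 2 * r0"
  \<comment> \<open>Since \<open>r0 < p\<close>, the annulus has width below \<open>2 * p\<close>.
    Thickened by \<open>p\<close> on both sides it has width below \<open>4 * p\<close>, still the
    fraction \<open>4 / 2 ^ k\<close> of \<open>r\<close>.\<close>
  define p where "p = r / 2 ^ k"
  define a where "a = avg h z R"
  define E where "E = ball z R - ball z r"
  \<comment> \<open>Bounds the average of \<open>\<bar>h - a\<bar>\<close> over a covering ball: 1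
    for its own oscillation, \<open>real (k + 1) * D\<close> for passing to radius
    \<open>10 * r\<close>, and \<open>D ^ 4\<close> for comparing that ball with
    \<open>ball z R\<close>.\<close>
  define G where "G = (1 + real (k + 1) * D + D ^ 4) * W"
  have "(2::real) ^ 1 \<le> 2 ^ k"
    using k by (intro power_increasing) auto
  then have k2: "(2::real) \<le> 2 ^ k"
    by simp
  have r_pos: "0 < r"
    using r r0 k2 by (meson less_trans mult_pos_pos zero_less_numeral zero_less_power)
  have p: "0 < p" "r0 < p" "2 * p \<le> r"
  proof -
    show "0 < p" "r0 < p"
      using r r_pos by (auto simp: p_def field_simps)
    have "2 * p \<le> 2 ^ k * p"
      using k2 \<open>0 < p\<close> by (intro mult_right_mono) auto
    then show "2 * p \<le> r"
      by (simp add: p_def)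
  qed
  have R: "r \<le> R" "R \<le> r + 2 * p" "0 < R"
    using r0 p r_pos by (auto simp: R_def)
  have W0: "0 \<le> W"
    using W[of 1 z] osc_nonneg[of h z 1] by simp
  have G0: "0 \<le> G"
    using W0 D_ge_1 by (simp add: G_def)
  have E: "E \<in> sets M"
    by (simp add: E_def)
  have EI: "u \<in> E \<longleftrightarrow> r \<le> dist z u \<and> dist z u < R" for u
    by (auto simp: E_def)
  have "0 < snd q \<and> snd q \<le> p" if "q \<in> (\<lambda>y. (y, p)) ` E" for q
    using that p by auto
  then obtain J where J: "J \<subseteq> (\<lambda>y. (y, p)) ` E" and disj: "disjoint_family_on (\<lambda>p. ball (fst p) (snd p)) J"
    and cover: "\<And>q. q \<in> (\<lambda>y. (y, p)) ` E \<Longrightarrow>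
      \<exists>q'\<in>J. snd q \<le> 2 * snd q' \<and> ball (fst q) (snd q) \<subseteq> ball (fst q') (5 * snd q')"
    using Vitali_covering[of "(\<lambda>y. (y, p)) ` E" p] by blast
  have J_E: "fst q \<in> E" "snd q = p" if "q \<in> J" for q
    using J that by auto
  have J_annulus: "ball (fst q) (snd q) \<subseteq> ball z (R + p) - ball z (r - p)" if q: "q \<in> J" for q
  proof
    fix u assume "u \<in> ball (fst q) (snd q)"
    then have "dist (fst q) u < p"
      using J_E[OF q] by simp
    moreover have "r \<le> dist z (fst q)" "dist z (fst q) < R"
      using J_E[OF q] EI by auto
    ultimately show "u \<in> ball z (R + p) - ball z (r - p)"
      using dist_triangle[of z u "fst q"] dist_triangle2[of z "fst q" u] by simp
  qed
  have finJ: "finite J"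
    using disjoint_balls_finite[OF disj \<open>0 < p\<close>, of z "R + p"] J_annulus J_E by fastforce
  define v where "v = (\<lambda>q::'a \<times> real. vol (fst q) (snd q))"
  have "(\<Sum>q\<in>J. v q) \<le> measure M (ball z (R + p) - ball z (r - p))"
    unfolding v_def using J_annulus by (intro sum_vol_le[OF finJ disj]) auto
  also have "\<dots> \<le> C * ((R + p - (r - p)) / (R + p)) powr \<beta> * vol z (R + p)"
    using p R by (intro decay) auto
  also have "\<dots> \<le> C * (4 / 2 ^ k) powr \<beta> * (D ^ 2 * vol z r)"
  proof (intro mult_mono vol_compare powr_mono2)
    have "(R + p - (r - p)) / (R + p) \<le> (4 * p) / r"
      using R p r_pos by (intro frac_le) auto
    also have "\<dots> = 4 / 2 ^ k"
      using r_pos by (simp add: p_def)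
    finally show "(R + p - (r - p)) / (R + p) \<le> 4 / 2 ^ k" .
  qed (use C \<beta> p R r_pos in auto)
  finally have sum_v: "(\<Sum>q\<in>J. v q) \<le> C * (4 / 2 ^ k) powr \<beta> * (D ^ 2 * vol z r)" .
  have piece: "(LINT u:ball (fst q) (5 * p)|M. \<bar>h u - a\<bar>) \<le> G * (D ^ 3 * v q)" if q: "q \<in> J" for q
  proof -
    let ?y = "fst q"
    let ?m = "avg h ?y (5 * p)"
    have y: "dist z ?y < R"
      using J_E[OF q] EI by auto
    have scale: "2 ^ (k + 1) * (5 * p) = 10 * r"
      by (simp add: p_def)
    have "\<bar>a - avg h ?y (10 * r)\<bar> \<le> D ^ 4 * osc h ?y (10 * r)"
      unfolding a_def using y R p r_pos by (intro abs_avg_diff_le_osc[OF h]) (auto simp: dist_commute)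
    also have "\<dots> \<le> D ^ 4 * W"
      using r_pos D_ge_1 by (intro mult_left_mono W) auto
    finally have "\<bar>?m - a\<bar> \<le> real (k + 1) * (D * W) + D ^ 4 * W"
      using avg_chain[OF h _ W, of "5 * p" ?y "k + 1"] p scale by auto
    moreover have "avg (\<lambda>u. \<bar>h u - ?m\<bar>) ?y (5 * p) \<le> W"
      using W[of "5 * p" ?y] p by (simp add: mean_oscillation_def)
    ultimately have avg_a: "avg (\<lambda>u. \<bar>h u - a\<bar>) ?y (5 * p) \<le> G"
      using avg_abs_diff_triangle[OF h, of "5 * p" ?y a ?m] p
      unfolding G_def by (simp add: algebra_simps)
    have "(LINT u:ball ?y (5 * p)|M. \<bar>h u - a\<bar>) = avg (\<lambda>u. \<bar>h u - a\<bar>) ?y (5 * p) * vol ?y (5 * p)"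
      using p by (intro set_integral_eq_avg) auto
    also have "\<dots> \<le> G * (D ^ 3 * v q)"
      unfolding v_def using avg_a G0 J_E[OF q] p by (intro mult_mono vol_compare) auto
    finally show ?thesis .
  qed
  have h_a: "(\<lambda>u. h u - a) \<in> L1_loc M"
    using L1_loc_add_const[OF h, of "- a"] by simp
  \<comment> \<open>\<open>h - a\<close> has mean zero on the larger ball, so its integral over
    \<open>ball z r\<close> is minus that over \<open>E\<close>. The difference of the averages thus
    becomes an integral over a set of small measure.\<close>
  have "0 = (LINT u:ball z R|M. h u - a)"
    using avg_add_const[OF h \<open>0 < R\<close>, of z "- a"] set_integral_eq_avg[OF \<open>0 < R\<close>, of z "\<lambda>u. h u - a"]
    by (simp add: a_def)
  also have "ball z R = ball z r \<union> E"
    using R by (auto simp: E_def)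
  also have "(LINT u:ball z r \<union> E|M. h u - a) = (LINT u:ball z r|M. h u - a) + (LINT u:E|M. h u - a)"
  proof (rule set_integral_Un)
    show "set_integrable M E (\<lambda>u. h u - a)"
      using L1_loc_integrable[OF h_a] E by (rule set_integrable_subset) (auto simp: E_def)
  qed (auto simp: E_def intro: L1_loc_integrable[OF h_a])
  also have "(LINT u:ball z r|M. h u - a) = (avg h z r - a) * vol z r"
    using avg_add_const[OF h r_pos, of z "- a"] set_integral_eq_avg[OF r_pos, of z "\<lambda>u. h u - a"] by simp
  finally have "(avg h z r - a) * vol z r = - (LINT u:E|M. h u - a)"
    by simp
  also have "\<dots> \<le> \<bar>LINT u:E|M. h u - a\<bar>"
    by simp
  also have "\<dots> \<le> (LINT u:E|M. \<bar>h u - a\<bar>)"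
    unfolding set_lebesgue_integral_def
    using integral_abs_bound[of M "\<lambda>u. indicat_real E u *\<^sub>R (h u - a)"] by (simp add: abs_mult)
  also have "\<dots> \<le> (\<Sum>q\<in>J. LINT u:ball (fst q) (5 * p)|M. \<bar>h u - a\<bar>)"
  proof (intro set_integral_le_sum_cover[OF finJ E])
    show "E \<subseteq> (\<Union>q\<in>J. ball (fst q) (5 * p))"
    proof
      fix u assume "u \<in> E"
      then obtain q where q: "q \<in> J" "ball u p \<subseteq> ball (fst q) (5 * snd q)"
        using cover[of "(u, p)"] by auto
      then have "u \<in> ball (fst q) (5 * p)"
        using p(1) J_E(2)[OF q(1)] by (metis centre_in_ball subsetD)
      then show "u \<in> (\<Union>q\<in>J. ball (fst q) (5 * p))"
        using q(1) by blast
    qed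
  qed (auto intro: L1_loc_integrable L1_loc_abs_diff h)
  also have "\<dots> \<le> (\<Sum>q\<in>J. G * (D ^ 3 * v q))"
    by (intro sum_mono piece)
  also have "\<dots> = G * (D ^ 3 * (\<Sum>q\<in>J. v q))"
    by (simp add: sum_distrib_left)
  also have "\<dots> \<le> G * (D ^ 3 * (C * (4 / 2 ^ k) powr \<beta> * (D ^ 2 * vol z r)))"
    using G0 D_ge_1 sum_v by (intro mult_left_mono) auto
  also have "\<dots> = (G * (D ^ 3 * (C * (4 / 2 ^ k) powr \<beta> * D ^ 2))) * vol z r"
    by (simp only: mult_ac)
  finally have "avg h z r - a \<le> G * (D ^ 3 * (C * (4 / 2 ^ k) powr \<beta> * D ^ 2))"
    using vol_pos[OF r_pos, of z] by (rule mult_right_le_imp_le)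
  then show ?thesis
    unfolding a_def R_def G_def by linarith
qed

end

text \<open>With \<open>q = 2 powr - \<beta>\<close> the expression is a combination of
  \<open>q ^ k\<close> and \<open>real k * q ^ k\<close>, and \<open>q < 1\<close>.\<close>

lemma annular_error_tendsto_0:
  fixes \<beta> :: real
  assumes "0 < \<beta>"
  shows "(\<lambda>k. (1 + real (k + 1) * D + E) * W * (A * (C * (4 / 2 ^ k) powr \<beta> * B))) \<longlonglongrightarrow> 0"
proof -
  define q where "q = 2 powr - \<beta>"
  have "q < 2 powr 0"
    unfolding q_def using assms by (intro powr_less_mono) auto
  then have q: "norm q < 1" "0 \<le> q"
    by (auto simp: q_def)
  have "(2 ^ k) powr \<beta> = (2 powr \<beta>) ^ k" for k
    by (simp add: powr_realpow[symmetric] powr_powr mult.commute)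
  then have "(4 / 2 ^ k) powr \<beta> = 4 powr \<beta> * q ^ k" for k
    by (simp add: q_def powr_divide powr_minus power_inverse divide_inverse[of "4 powr \<beta>"])
  then have eq: "(\<lambda>k. (1 + real (k + 1) * D + E) * W * (A * (C * (4 / 2 ^ k) powr \<beta> * B)))
      = (\<lambda>k. W * A * C * B * 4 powr \<beta> * ((1 + D + E) * q ^ k + D * (real k * q ^ k)))"
    by (simp add: algebra_simps)
  have "(\<lambda>k. W * A * C * B * 4 powr \<beta> * ((1 + D + E) * q ^ k + D * (real k * q ^ k)))
      \<longlonglongrightarrow> W * A * C * B * 4 powr \<beta> * ((1 + D + E) * 0 + D * 0)"
    using q powser_times_n_limit_0[OF q(1)]
    by (intro tendsto_intros LIMSEQ_power_zero) auto
  then show ?thesis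
    unfolding eq by simp
qed

subsection \<open>BLO and VMO estimates\<close>

context doubling_constant
begin

lemma ex_ball_of_AE:
  assumes "AE y in M. y \<in> ball x r \<longrightarrow> P y" "0 < r"
  shows "\<exists>y\<in>ball x r. P y"
proof (rule ccontr)
  assume "\<not> ?thesis"
  then have "AE y in M. y \<notin> ball x r"
    using assms(1) by (auto elim!: eventually_mono)
  then have "ball x r \<in> null_sets M"
    by (subst AE_iff_null_sets) (auto intro: sets_open)
  then have "emeasure M (ball x r) = 0"
    by auto
  then show False
    using ball_pos[OF assms(2), of x] by simp
qed

text \<open>A constant \<open>m\<close> below \<open>g\<close> almost everywhere on one ball, with
  mean excess at most \<open>L\<close>, is all that the norms need: it yields integrability, the
  lower oscillation bound \<open>L\<close> and the mean oscillation bound \<open>2 * L\<close> on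
  that ball.\<close>

context
  fixes g :: "'a \<Rightarrow> real" and z :: 'a and r m L :: real
  assumes r: "0 < r" and m: "0 \<le> m" and L: "0 \<le> L"
    and g: "g \<in> borel_measurable M" "\<And>y. 0 \<le> g y"
    and lower: "AE y in M. y \<in> ball z r \<longrightarrow> m \<le> g y"
    and excess: "(\<integral>\<^sup>+y\<in>ball z r. ennreal (g y - m) \<partial>M) \<le> ennreal (L * vol z r)"
begin

lemma set_integrable_of_excess: "set_integrable M (ball z r) g"
  unfolding set_integrable_def
proof (rule integrableI_nonneg)
  have [measurable]: "g \<in> borel_measurable M"
    by (rule g)
  show "(\<lambda>y. indicat_real (ball z r) y *\<^sub>R g y) \<in> borel_measurable M"
    by measurable
  show "AE y in M. 0 \<le> indicat_real (ball z r) y *\<^sub>R g y"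
    using g(2) by simp
  have "(\<integral>\<^sup>+y. ennreal (indicat_real (ball z r) y *\<^sub>R g y) \<partial>M)
      \<le> (\<integral>\<^sup>+y. ennreal (g y - m) * indicator (ball z r) y + ennreal m * indicator (ball z r) y \<partial>M)"
  proof (intro nn_integral_mono)
    fix y
    have "ennreal (g y) \<le> ennreal (max 0 (g y - m) + m)"
      by (intro ennreal_leI) simp
    also have "\<dots> = ennreal (g y - m) + ennreal m"
      using m by (subst ennreal_plus) (auto simp: ennreal_max_0)
    finally show "ennreal (indicat_real (ball z r) y *\<^sub>R g y)
        \<le> ennreal (g y - m) * indicator (ball z r) y + ennreal m * indicator (ball z r) y"
      by (auto split: split_indicator)
  qed
  also have "\<dots> = (\<integral>\<^sup>+y\<in>ball z r. ennreal (g y - m) \<partial>M) + (\<integral>\<^sup>+y\<in>ball z r. ennreal m \<partial>M)"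
    by (intro nn_integral_add) auto
  also have "\<dots> \<le> ennreal (L * vol z r) + ennreal (m * vol z r)"
    using m by (intro add_mono excess nn_integral_ball_le) auto
  also have "\<dots> < \<infinity>"
    by simp
  finally show "(\<integral>\<^sup>+y. ennreal (indicat_real (ball z r) y *\<^sub>R g y) \<partial>M) < \<infinity>" .
qed

lemma lower_oscillation_of_excess:
  "(\<integral>\<^sup>+y\<in>ball z r. e2ennreal (ereal (g y) - essinf_on M (ball z r) g) \<partial>M) / emeasure M (ball z r)
    \<le> ennreal L"
proof -
  \<comment> \<open>\<open>m\<close> competes in the supremum defining the essential infimum, so
    subtracting the latter leaves at most \<open>g - m\<close>.\<close>
  have "ereal m \<le> essinf_on M (ball z r) g"
    unfolding essinf_on_def using lower by (intro Sup_upper) (auto elim!: eventually_mono)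
  then have "e2ennreal (ereal (g y) - essinf_on M (ball z r) g) \<le> ennreal (g y - m)" for y
    using e2ennreal_mono[OF ereal_minus_mono[OF order_refl[of "ereal (g y)"]]]
    by (metis e2ennreal_ereal ereal_minus(1))
  then have "(\<integral>\<^sup>+y\<in>ball z r. e2ennreal (ereal (g y) - essinf_on M (ball z r) g) \<partial>M)
      \<le> (\<integral>\<^sup>+y\<in>ball z r. ennreal (g y - m) \<partial>M)"
    by (intro nn_integral_mono mult_right_mono) auto
  also note excess
  finally have "(\<integral>\<^sup>+y\<in>ball z r. e2ennreal (ereal (g y) - essinf_on M (ball z r) g) \<partial>M) / emeasure M (ball z r)
      \<le> ennreal (L * vol z r) / emeasure M (ball z r)"
    by (rule divide_right_mono_ennreal)
  also have "\<dots> = ennreal L"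
    using L vol_pos[OF r, of z] by (simp add: emeasure_ball divide_ennreal)
  finally show ?thesis .
qed

lemma osc_of_excess:
  assumes "g \<in> L1_loc M"
  shows "osc g z r \<le> 2 * L"
proof -
  have "ennreal (avg (\<lambda>u. \<bar>g u - m\<bar>) z r * vol z r) = (\<integral>\<^sup>+y\<in>ball z r. ennreal \<bar>g y - m\<bar> \<partial>M)"
    using nn_integral_ball_eq[OF L1_loc_abs_diff[OF assms] _ r] by simp
  also have "\<dots> = (\<integral>\<^sup>+y\<in>ball z r. ennreal (g y - m) \<partial>M)"
    using lower by (intro nn_integral_cong_AE) (auto elim!: eventually_mono split: split_indicator)
  also note excess
  finally have "avg (\<lambda>u. \<bar>g u - m\<bar>) z r * vol z r \<le> L * vol z r"
    using L by (subst (asm) ennreal_le_iff) auto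
  then have "avg (\<lambda>u. \<bar>g u - m\<bar>) z r \<le> L"
    using vol_pos[OF r, of z] by (rule mult_right_le_imp_le)
  then show ?thesis
    using osc_le_avg[OF assms r, of z m] by linarith
qed

end

section \<open>Pointwise forms of the BMO and VMO conditions\<close>

lemma BMO_norm_ge: "0 < r \<Longrightarrow> ennreal (osc f z r) \<le> BMO_norm M f"
  unfolding BMO_norm_def by (rule SUP_upper2[where i = "(z, r)"]) auto

lemma osc_le_BMO_norm:
  assumes "f \<in> BMO M" "0 < r"
  shows "osc f z r \<le> enn2real (BMO_norm M f)"
proof -
  have "BMO_norm M f = ennreal (enn2real (BMO_norm M f))"
    using assms(1) by (simp add: BMO_def)
  then have "ennreal (osc f z r) \<le> ennreal (enn2real (BMO_norm M f))"
    using BMO_norm_ge[OF assms(2), of f z] by simp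
  then show ?thesis
    by (subst (asm) ennreal_le_iff) auto
qed

lemma VMO_osc_small:
  assumes "f \<in> VMO M" "0 < e"
  shows "\<exists>d>0. \<forall>z r. 0 < r \<longrightarrow> r \<le> d \<longrightarrow> osc f z r \<le> e"
proof -
  let ?S = "\<lambda>r. SUP (z, s) \<in> UNIV \<times> {0<..r}. ennreal (osc f z s)"
  have "(?S \<longlongrightarrow> 0) (at_right 0)"
    using assms(1) by (simp add: VMO_def)
  then have "\<forall>\<^sub>F r in at_right 0. ?S r < ennreal e"
    using assms(2) by (intro order_tendstoD(2)) auto
  then obtain b where b: "0 < b" "\<And>r. 0 < r \<Longrightarrow> r < b \<Longrightarrow> ?S r < ennreal e"
    unfolding eventually_at_right_field by blast
  have "osc f z r \<le> e" if "0 < r" "r \<le> b / 2" for z r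
  proof -
    have "ennreal (osc f z r) \<le> ?S (b / 2)"
      using that by (intro SUP_upper2[where i = "(z, r)"]) auto
    also have "\<dots> < ennreal e"
      using b by simp
    finally show ?thesis
      using assms(2) by (simp add: ennreal_less_iff osc_nonneg)
  qed
  then show ?thesis
    using b(1) by (intro exI[of _ "b / 2"]) auto
qed

lemma VMO_I:
  assumes "f \<in> BMO M"
    and "\<And>e. 0 < e \<Longrightarrow> \<exists>d>0. \<forall>z r. 0 < r \<longrightarrow> r \<le> d \<longrightarrow> osc f z r \<le> e"
  shows "f \<in> VMO M"
proof -
  let ?S = "\<lambda>r. SUP (z, s) \<in> UNIV \<times> {0<..r}. ennreal (osc f z s)"
  have "(?S \<longlongrightarrow> 0) (at_right 0)"
  proof (rule order_tendstoI)
    fix a :: ennreal assume "0 < a"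
    then obtain c where c: "0 < c" "c < a"
      using dense by blast
    then obtain e where e: "c = ennreal e" "0 \<le> e"
      by (cases c) auto
    then have "0 < e"
      using c(1) by simp
    then obtain d where d: "0 < d" "\<And>z r. 0 < r \<Longrightarrow> r \<le> d \<Longrightarrow> osc f z r \<le> e"
      using assms(2) by blast
    have "?S r < a" if "0 < r" "r < d" for r
    proof -
      have "?S r \<le> c"
        unfolding e(1) using that d(2) by (intro SUP_least) (auto intro!: ennreal_leI)
      then show ?thesis
        using c(2) by (rule le_less_trans)
    qed
    then show "\<forall>\<^sub>F r in at_right 0. ?S r < a"
      unfolding eventually_at_right_field using d(1) by blast
  qed simp
  then show ?thesis
    using assms(1) by (simp add: VMO_def)
qed

section \<open>The maximal function of a BMO function\<close>

context
  fixes f :: "'a \<Rightarrow> real" and \<alpha> K :: real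
  assumes \<alpha>: "0 \<le> \<alpha>" and K: "0 < K"
    and powr_le_K: "\<And>r. 0 < r \<Longrightarrow> ereal r < 2 * ediam (UNIV :: 'a set) \<Longrightarrow> r powr \<alpha> \<le> K"
    and f: "f \<in> BMO M"
begin

abbreviation Mf where "Mf \<equiv> frac_maximal M \<alpha> f"
abbreviation W where "W \<equiv> enn2real (BMO_norm M f)"

lemma BMO_L1_loc: "f \<in> L1_loc M"
  using f by (simp add: BMO_def)

lemma osc_abs_le_BMO_norm: "0 < r \<Longrightarrow> osc (\<lambda>u. \<bar>f u\<bar>) z r \<le> 2 * W"
  using osc_abs_le[OF BMO_L1_loc, of r z] osc_le_BMO_norm[OF f, of r z] by linarith

text \<open>On a bounded space every admissible radius is below \<open>R\<close>, so a single local
  maximal function controls \<open>Mf\<close>, and its integral over a ball is finite. This supplies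
  finiteness when \<open>\<alpha> > 0\<close>.\<close>

lemma frac_maximal_finite_bounded:
  assumes "bounded (UNIV :: 'a set)"
  shows "\<exists>x. Mf x \<noteq> \<infinity>"
proof -
  fix x0 :: 'a
  define R where "R = 2 * diameter (UNIV :: 'a set)"
  define c where "c = avg (\<lambda>u. \<bar>f u\<bar>) x0 (3 * R)"
  define T where "T = local_maximal (\<lambda>u. \<bar>f u\<bar>) c 0 R"
  have R: "0 < R"
    using diameter_pos[OF assms] by (simp add: R_def)
  have [measurable]: "T \<in> borel_measurable M"
    by (simp add: T_def)
  have "(\<integral>\<^sup>+y\<in>ball x0 R. T y \<partial>M) \<le> ennreal ((6 * D ^ 5 + 2 * D ^ 9) * (2 * W) * vol x0 R)"
    unfolding T_def c_def using R osc_abs_le_BMO_norm by (intro maximal_integral_le L1_loc_abs BMO_L1_loc) auto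
  then have "AE y in M. T y * indicator (ball x0 R) y \<noteq> \<infinity>"
    by (intro nn_integral_PInf_AE) (auto simp: top_unique)
  then have "AE y in M. y \<in> ball x0 R \<longrightarrow> T y \<noteq> \<infinity>"
    by eventually_elim auto
  from ex_ball_of_AE[OF this R] obtain y where y: "y \<in> ball x0 R" "T y \<noteq> \<infinity>"
    by blast
  have "Mf y \<le> ennreal K * (ennreal c + T y)"
  proof (rule frac_maximal_leI[OF BMO_L1_loc])
    fix z r assume z: "dist z y < r" "0 < r" and r: "ereal r < 2 * ediam (UNIV :: 'a set)"
    let ?a = "avg (\<lambda>u. \<bar>\<bar>f u\<bar> - c\<bar>) z r"
    have "r < R"
      using r assms unfolding less_two_ediam_iff R_def by simp
    have nonneg: "0 \<le> ?a" "0 \<le> c" "0 \<le> avg (\<lambda>u. \<bar>f u\<bar>) z r"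
      by (auto simp: c_def intro: avg_nonneg)
    have "avg (\<lambda>u. \<bar>f u\<bar>) z r \<le> c + ?a"
      using abs_avg_diff_le[OF L1_loc_abs[OF BMO_L1_loc] z(2), of z c] by linarith
    then have "r powr \<alpha> * avg (\<lambda>u. \<bar>f u\<bar>) z r \<le> K * (c + ?a)"
      using powr_le_K[OF z(2) r] nonneg K by (intro mult_mono) auto
    then have "ennreal (r powr \<alpha> * avg (\<lambda>u. \<bar>f u\<bar>) z r) \<le> ennreal (K * (c + ?a))"
      by (rule ennreal_leI)
    also have "\<dots> = ennreal K * (ennreal c + ennreal ?a)"
      using K nonneg by (simp add: ennreal_mult)
    also have "\<dots> \<le> ennreal K * (ennreal c + T y)"
      unfolding T_def using z \<open>r < R\<close> by (intro mult_left_mono add_left_mono local_maximal_ge) auto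
    finally show "ennreal (r powr \<alpha> * avg (\<lambda>u. \<bar>f u\<bar>) z r) \<le> ennreal K * (ennreal c + T y)" .
  qed
  moreover have "ennreal K * (ennreal c + T y) < \<infinity>"
    using y(2) by (simp add: ennreal_mult_less_top less_top)
  ultimately have "Mf y < \<infinity>"
    by (rule le_less_trans)
  then have "Mf y \<noteq> \<infinity>"
    by (rule less_imp_neq)
  then show ?thesis
    by blast
qed

context
  assumes fin: "\<exists>x. Mf x \<noteq> \<infinity>"
begin

text \<open>Countably many balls around a point of finiteness exhaust the space, and each contains
  that point, so finiteness spreads to almost all of each.\<close>

lemma frac_maximal_finite_AE: "AE x in M. Mf x < \<infinity>"
proof -
  obtain x1 where x1: "Mf x1 \<noteq> \<infinity>"
    using fin by blast
  have "AE y in M. y \<in> ball x1 (real (Suc n)) \<longrightarrow> Mf y < \<infinity>" for n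
    using K osc_abs_le_BMO_norm x1
      avg_le_enlarged_avg[OF L1_loc_abs[OF BMO_L1_loc], of "real (Suc n)" _ "2 * W"]
    by (intro frac_maximal_oscillation(1)[OF BMO_L1_loc \<alpha> _ powr_le_K, where \<theta> = "D\<^sup>2 * (2 * W)" and w = "2 * W" and k = 0
        and ?x1.0 = x1]) auto
  then have "AE y in M. \<forall>n. y \<in> ball x1 (real (Suc n)) \<longrightarrow> Mf y < \<infinity>"
    by (subst AE_all_countable) blast
  then show ?thesis
  proof eventually_elim
    case (elim y)
    obtain n where "dist x1 y < real (Suc n)"
      using reals_Archimedean2 less_trans by (metis lessI of_nat_less_iff)
    then show ?case
      using elim by auto
  qed
qed

text \<open>Finiteness almost everywhere puts a point of finiteness into every ball, which makes the
  excess bound available on all of them.\<close>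

lemma frac_maximal_excess:
  assumes "0 < r" and "0 \<le> \<theta>" and "0 \<le> w"
    and large: "\<And>z s. 2 ^ k * r < s \<Longrightarrow>
      avg (\<lambda>u. \<bar>f u\<bar>) z s \<le> avg (\<lambda>u. \<bar>f u\<bar>) z (s + 2 * r) + \<theta>"
    and osc: "\<And>z s. 0 < s \<Longrightarrow> s \<le> 3 * (2 ^ k * r) \<Longrightarrow> osc (\<lambda>u. \<bar>f u\<bar>) z s \<le> w"
  obtains m where "0 \<le> m"
    "AE y in M. y \<in> ball z r \<longrightarrow> m \<le> enn2real (Mf y)"
    "(\<integral>\<^sup>+y\<in>ball z r. ennreal (enn2real (Mf y) - m) \<partial>M)
      \<le> ennreal (K * (\<theta> + (6 * D ^ 5 + 2 * D ^ 9) * D ^ k * w) * vol z r)"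
proof -
  have "AE x in M. x \<in> ball z r \<longrightarrow> Mf x \<noteq> \<infinity>"
    using frac_maximal_finite_AE by eventually_elim auto
  from ex_ball_of_AE[OF this assms(1)] obtain x1 where x1: "x1 \<in> ball z r" "Mf x1 \<noteq> \<infinity>"
    by blast
  obtain m where m: "0 \<le> m" "\<And>y. y \<in> ball z r \<Longrightarrow> Mf y < \<infinity> \<Longrightarrow> m \<le> enn2real (Mf y)"
    "(\<integral>\<^sup>+y\<in>ball z r. ennreal (enn2real (Mf y) - m) \<partial>M)
      \<le> ennreal (K * (\<theta> + (6 * D ^ 5 + 2 * D ^ 9) * D ^ k * w) * vol z r)"
    using frac_maximal_oscillation(2)[OF BMO_L1_loc \<alpha> less_imp_le[OF K] powr_le_K assms x1] by blast
  have "AE y in M. y \<in> ball z r \<longrightarrow> m \<le> enn2real (Mf y)"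
    using frac_maximal_finite_AE by eventually_elim (use m(2) in blast)
  with m that show thesis
    by blast
qed

abbreviation Mfr where "Mfr \<equiv> (\<lambda>x. enn2real (Mf x))"

lemma Mfr_measurable: "Mfr \<in> borel_measurable M"
  using frac_maximal_measurable[OF BMO_L1_loc] by measurable

text \<open>The case \<open>k = 0\<close>, where both errors are multiples of \<open>W\<close>. The
  factor 2 in \<open>2 * W\<close> comes from passing to \<open>\<bar>f\<bar>\<close>.\<close>

lemma frac_maximal_BLO_excess:
  assumes "0 < r"
  obtains m where "0 \<le> m" "AE y in M. y \<in> ball z r \<longrightarrow> m \<le> Mfr y"
    "(\<integral>\<^sup>+y\<in>ball z r. ennreal (Mfr y - m) \<partial>M)
      \<le> ennreal ((K * (2 * D ^ 2 + 2 * (6 * D ^ 5 + 2 * D ^ 9)) * W) * vol z r)"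
proof -
  have eq: "K * (D ^ 2 * (2 * W) + (6 * D ^ 5 + 2 * D ^ 9) * D ^ 0 * (2 * W))
      = K * (2 * D ^ 2 + 2 * (6 * D ^ 5 + 2 * D ^ 9)) * W"
    by (simp add: algebra_simps)
  have large: "avg (\<lambda>u. \<bar>f u\<bar>) z s \<le> avg (\<lambda>u. \<bar>f u\<bar>) z (s + 2 * r) + D ^ 2 * (2 * W)"
    if "2 ^ 0 * r < s" for z s
    using that assms by (intro avg_le_enlarged_avg L1_loc_abs BMO_L1_loc osc_abs_le_BMO_norm) auto
  show thesis
  proof (rule frac_maximal_excess[OF assms _ _ large osc_abs_le_BMO_norm, of 0 z])
    fix m assume "0 \<le> m" "AE y in M. y \<in> ball z r \<longrightarrow> m \<le> Mfr y"
      "(\<integral>\<^sup>+y\<in>ball z r. ennreal (Mfr y - m) \<partial>M)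
        \<le> ennreal (K * (D ^ 2 * (2 * W) + (6 * D ^ 5 + 2 * D ^ 9) * D ^ 0 * (2 * W)) * vol z r)"
    then show thesis
      using that unfolding eq by blast
  qed auto
qed

lemma frac_maximal_L1_loc: "Mfr \<in> L1_loc M"
  unfolding L1_loc_def
proof (intro CollectI allI impI)
  fix z r assume r: "(0::real) < r"
  obtain m where m: "0 \<le> m" "AE y in M. y \<in> ball z r \<longrightarrow> m \<le> Mfr y"
    "(\<integral>\<^sup>+y\<in>ball z r. ennreal (Mfr y - m) \<partial>M)
      \<le> ennreal ((K * (2 * D ^ 2 + 2 * (6 * D ^ 5 + 2 * D ^ 9)) * W) * vol z r)"
    using frac_maximal_BLO_excess[OF r] .
  show "set_integrable M (ball z r) Mfr"
    using K D_ge_1 by (intro set_integrable_of_excess[OF r m(1) _ Mfr_measurable _ m(2,3)]) auto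
qed

lemma BLO_norm_frac_maximal_le:
  "BLO_norm M Mfr \<le> ennreal (K * (2 * D ^ 2 + 2 * (6 * D ^ 5 + 2 * D ^ 9))) * BMO_norm M f"
proof -
  let ?C = "K * (2 * D ^ 2 + 2 * (6 * D ^ 5 + 2 * D ^ 9))"
  have C: "0 \<le> ?C"
    using K D_ge_1 by auto
  have "BLO_norm M Mfr \<le> ennreal (?C * W)"
    unfolding BLO_norm_def
  proof (rule SUP_least)
    fix p :: "'a \<times> real" assume "p \<in> UNIV \<times> {0<..}"
    then obtain z r where p: "p = (z, r)" and r: "0 < r"
      by auto
    obtain m where m: "0 \<le> m" "AE y in M. y \<in> ball z r \<longrightarrow> m \<le> Mfr y"
      "(\<integral>\<^sup>+y\<in>ball z r. ennreal (Mfr y - m) \<partial>M) \<le> ennreal ((?C * W) * vol z r)"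
      using frac_maximal_BLO_excess[OF r] .
    show "(case p of (z, r) \<Rightarrow> (\<integral>\<^sup>+y\<in>ball z r. e2ennreal (ereal (Mfr y) - essinf_on M (ball z r) Mfr) \<partial>M)
        / emeasure M (ball z r)) \<le> ennreal (?C * W)"
      unfolding p prod.case
      using C by (intro lower_oscillation_of_excess[OF r m(1) _ Mfr_measurable _ m(2,3)]) auto
  qed
  also have "\<dots> = ennreal ?C * ennreal W"
    using C by (intro ennreal_mult) auto
  also have "ennreal W = BMO_norm M f"
    using f by (simp add: BMO_def)
  finally show ?thesis .
qed

lemma frac_maximal_BLO: "Mfr \<in> BLO M"
proof -
  have "BMO_norm M f < \<infinity>"
    using f by (simp add: BMO_def)
  then have "BLO_norm M Mfr < \<infinity>"
    by (intro le_less_trans[OF BLO_norm_frac_maximal_le]) (auto simp: ennreal_mult_less_top)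
  then show ?thesis
    using frac_maximal_L1_loc by (simp add: BLO_def)
qed

lemma frac_maximal_BMO: "Mfr \<in> BMO M"
proof -
  let ?L = "K * (2 * D ^ 2 + 2 * (6 * D ^ 5 + 2 * D ^ 9)) * W"
  have "BMO_norm M Mfr \<le> ennreal (2 * ?L)"
  proof (subst BMO_norm_def, rule SUP_least)
    fix p :: "'a \<times> real" assume "p \<in> UNIV \<times> {0<..}"
    then obtain z r where p: "p = (z, r)" and r: "0 < r"
      by auto
    obtain m where m: "0 \<le> m" "AE y in M. y \<in> ball z r \<longrightarrow> m \<le> Mfr y"
      "(\<integral>\<^sup>+y\<in>ball z r. ennreal (Mfr y - m) \<partial>M) \<le> ennreal (?L * vol z r)"
      using frac_maximal_BLO_excess[OF r] .
    show "(case p of (z, r) \<Rightarrow> ennreal (osc Mfr z r)) \<le> ennreal (2 * ?L)"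
      unfolding p prod.case using K D_ge_1 frac_maximal_L1_loc
      by (intro ennreal_leI osc_of_excess[OF r m(1) _ Mfr_measurable _ m(2,3)]) auto
  qed
  then have "BMO_norm M Mfr < \<infinity>"
    by (rule le_less_trans) simp
  then show ?thesis
    using frac_maximal_L1_loc by (simp add: BMO_def)
qed

text \<open>The order of choice matters. First comes \<open>k\<close>, through annular decay and the
  BMO norm only, since balls above the scale \<open>2 ^ k * r\<close> need not be small. Then comes
  the radius \<open>d\<close>, since the vanishing oscillation has to absorb the factor
  \<open>D ^ k\<close>.\<close>

lemma frac_maximal_VMO:
  assumes "annular_decay M" and "f \<in> VMO M"
  shows "Mfr \<in> VMO M"
proof (rule VMO_I[OF frac_maximal_BMO])
  fix e :: real assume e: "0 < e"
  obtain \<beta> C where \<beta>: "0 < \<beta>" and C: "1 \<le> C"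
    and decay: "\<And>x r R. 0 < r \<Longrightarrow> r \<le> R \<Longrightarrow>
      measure M (ball x R - ball x r) \<le> C * ((R - r) / R) powr \<beta> * vol x R"
    using assms(1) unfolding annular_decay_def by blast
  define \<eta> where "\<eta> = (\<lambda>k. (1 + real (k + 1) * D + D ^ 4) * (2 * W) * (D ^ 3 * (C * (4 / 2 ^ k) powr \<beta> * D ^ 2)))"
  have "\<eta> \<longlonglongrightarrow> 0"
    unfolding \<eta>_def by (rule annular_error_tendsto_0[OF \<beta>])
  then have "\<forall>\<^sub>F k in sequentially. \<eta> k < e / (4 * K)"
    using e K by (intro order_tendstoD(2)) auto
  then obtain k where k: "1 \<le> k" "\<eta> k < e / (4 * K)"
    using eventually_ge_at_top[of 1] by (metis (mono_tags, lifting) eventually_conj eventually_happens' sequentially_bot)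
  have \<eta>: "0 \<le> \<eta> k"
    using D_ge_1 C by (simp add: \<eta>_def)
  have large: "avg (\<lambda>u. \<bar>f u\<bar>) z s \<le> avg (\<lambda>u. \<bar>f u\<bar>) z (s + 2 * r) + \<eta> k"
    if "0 < r" "2 ^ k * r < s" for z r s
    unfolding \<eta>_def using that k(1) \<beta> C decay osc_abs_le_BMO_norm
    by (intro avg_le_enlarged_avg_annular_decay L1_loc_abs BMO_L1_loc) auto
  define B where "B = (6 * D ^ 5 + 2 * D ^ 9) * D ^ k"
  have B: "0 < B"
    using D_ge_1 by (simp add: B_def add_pos_pos)
  \<comment> \<open>In the final bound \<open>2 * L\<close> this makes the small balls contribute
    \<open>e / 2\<close>; the choice of \<open>k\<close> leaves at most \<open>e / 2\<close> for the
    large ones.\<close>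
  define w where "w = e / (4 * K * B)"
  have w: "0 < w"
    using e K B by (simp add: w_def)
  obtain d where d: "0 < d" "\<And>z r. 0 < r \<Longrightarrow> r \<le> d \<Longrightarrow> osc f z r \<le> w / 2"
    using VMO_osc_small[OF assms(2), of "w / 2"] w by auto
  have osc_w: "osc (\<lambda>u. \<bar>f u\<bar>) z s \<le> w" if "0 < s" "s \<le> d" for z s
    using osc_abs_le[OF BMO_L1_loc that(1), of z] d(2)[OF that, of z] by linarith
  have "osc Mfr z r \<le> e" if r: "0 < r" "r \<le> d / (3 * 2 ^ k)" for z r
  proof -
    define L where "L = K * (\<eta> k + B * w)"
    have L: "0 \<le> L"
      using K \<eta> B w by (simp add: L_def)
    have "3 * (2 ^ k * r) \<le> d"
      using r(2) by (simp add: field_simps)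
    then obtain m where m: "0 \<le> m" "AE y in M. y \<in> ball z r \<longrightarrow> m \<le> Mfr y"
      "(\<integral>\<^sup>+y\<in>ball z r. ennreal (Mfr y - m) \<partial>M) \<le> ennreal (L * vol z r)"
      unfolding L_def B_def
      using frac_maximal_excess[OF r(1) \<eta> less_imp_le[OF w] large[OF r(1)], of k z] osc_w by force
    have "osc Mfr z r \<le> 2 * L"
      using L frac_maximal_L1_loc by (intro osc_of_excess[OF r(1) m(1) _ Mfr_measurable _ m(2,3)]) auto
    also have "\<dots> = 2 * (K * \<eta> k) + 2 * (K * (B * w))"
      by (simp add: L_def distrib_left)
    also have "K * (B * w) = e / 4"
      using K B by (simp add: w_def)
    also have "K * \<eta> k \<le> e / 4"
      using k(2) K by (simp add: field_simps)
    finally show ?thesis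
      by simp
  qed
  then show "\<exists>d>0. \<forall>z r. 0 < r \<longrightarrow> r \<le> d \<longrightarrow> osc Mfr z r \<le> e"
    using d(1) by (intro exI[of _ "d / (3 * 2 ^ k)"]) auto
qed

end

end

end

section \<open>Boundedness from BMO to BLO and preservation of VMO\<close>

theorem theorem1p1:
  fixes M :: "'a::metric_space measure" and \<alpha> Q :: real
  assumes "doubling_metric_measure_space M"
    and "0 \<le> \<alpha>"
    and "0 < \<alpha> \<Longrightarrow> bounded (UNIV :: 'a set) \<and> 0 < Q \<and> lower_mass_bound M Q \<and> \<alpha> < Q"
  shows "(\<exists>C>0. \<forall>f \<in> BMO M. (\<alpha> = 0 \<longrightarrow> (\<exists>x. frac_maximal M \<alpha> f x \<noteq> \<infinity>)) \<longrightarrow>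
            (AE x in M. frac_maximal M \<alpha> f x < \<infinity>) \<and>
            (\<lambda>x. enn2real (frac_maximal M \<alpha> f x)) \<in> BLO M \<and>
            BLO_norm M (\<lambda>x. enn2real (frac_maximal M \<alpha> f x)) \<le> ennreal C * BMO_norm M f)
       \<and> (annular_decay M \<longrightarrow>
            (\<forall>f \<in> VMO M. (\<alpha> = 0 \<longrightarrow> (\<exists>x. frac_maximal M \<alpha> f x \<noteq> \<infinity>)) \<longrightarrow>
              (AE x in M. frac_maximal M \<alpha> f x < \<infinity>) \<and>
              (\<lambda>x. enn2real (frac_maximal M \<alpha> f x)) \<in> VMO M))"
proof -
  interpret doubling_metric_measure_space M
    by (rule assms(1))
  obtain D where D: "1 \<le> D" "\<And>x r. 0 < r \<Longrightarrow> measure M (ball x (2 * r)) \<le> D * measure M (ball x r)"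
    using doubling by blast
  interpret doubling_constant M D
    by unfold_locales (use D in auto)
  \<comment> \<open>For \<open>\<alpha> = 0\<close> every weight is 1; otherwise the space is
    bounded and admissible radii stay below twice the diameter.\<close>
  have "\<exists>K>0. \<forall>r. 0 < r \<longrightarrow> ereal r < 2 * ediam (UNIV :: 'a set) \<longrightarrow> r powr \<alpha> \<le> K"
  proof (cases "\<alpha> = 0")
    case True
    then show ?thesis
      by (intro exI[of _ 1]) auto
  next
    case False
    then have bdd: "bounded (UNIV :: 'a set)"
      using assms(2,3) by simp
    have "r powr \<alpha> \<le> (2 * diameter (UNIV :: 'a set)) powr \<alpha>"
      if "0 < r" "ereal r < 2 * ediam (UNIV :: 'a set)" for r
      using that bdd assms(2) unfolding less_two_ediam_iff by (intro powr_mono2) auto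
    then show ?thesis
      using diameter_pos[OF bdd] by (intro exI[of _ "(2 * diameter (UNIV :: 'a set)) powr \<alpha>"]) auto
  qed
  then obtain K where K: "0 < K"
    "\<And>r. 0 < r \<Longrightarrow> ereal r < 2 * ediam (UNIV :: 'a set) \<Longrightarrow> r powr \<alpha> \<le> K"
    by blast
  \<comment> \<open>For \<open>\<alpha> = 0\<close> this is assumed; for positive
    \<open>\<alpha>\<close> it follows from boundedness of the space.\<close>
  have fin: "\<exists>x. frac_maximal M \<alpha> f x \<noteq> \<infinity>"
    if "f \<in> BMO M" "\<alpha> = 0 \<longrightarrow> (\<exists>x. frac_maximal M \<alpha> f x \<noteq> \<infinity>)" for f
    using frac_maximal_finite_bounded[OF assms(2) K that(1)] that(2) assms(2,3) by (cases "\<alpha> = 0") auto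
  \<comment> \<open>Built from \<open>K\<close> and \<open>D\<close> alone, hence the same for all
    \<open>f\<close>.\<close>
  let ?C = "K * (2 * D ^ 2 + 2 * (6 * D ^ 5 + 2 * D ^ 9))"
  have "0 < ?C"
    using K(1) D(1) by (simp add: add_pos_pos)
  moreover have "(AE x in M. frac_maximal M \<alpha> f x < \<infinity>) \<and>
      (\<lambda>x. enn2real (frac_maximal M \<alpha> f x)) \<in> BLO M \<and>
      BLO_norm M (\<lambda>x. enn2real (frac_maximal M \<alpha> f x)) \<le> ennreal ?C * BMO_norm M f"
    if "f \<in> BMO M" "\<alpha> = 0 \<longrightarrow> (\<exists>x. frac_maximal M \<alpha> f x \<noteq> \<infinity>)" for f
    using frac_maximal_finite_AE[OF assms(2) K that(1) fin[OF that]]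
      frac_maximal_BLO[OF assms(2) K that(1) fin[OF that]]
      BLO_norm_frac_maximal_le[OF assms(2) K that(1) fin[OF that]] by blast
  moreover have "(AE x in M. frac_maximal M \<alpha> f x < \<infinity>) \<and>
      (\<lambda>x. enn2real (frac_maximal M \<alpha> f x)) \<in> VMO M"
    if "annular_decay M" "f \<in> VMO M" "\<alpha> = 0 \<longrightarrow> (\<exists>x. frac_maximal M \<alpha> f x \<noteq> \<infinity>)" for f
  proof -
    have f: "f \<in> BMO M"
      using that(2) by (simp add: VMO_def)
    show ?thesis
      using frac_maximal_finite_AE[OF assms(2) K f fin[OF f that(3)]]
        frac_maximal_VMO[OF assms(2) K f fin[OF f that(3)] that(1,2)] by blast
  qed
  ultimately show ?thesis
    by blast
qed

end
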